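(* Let $k$ be a field of characteristic $2$ and let $L$ be a restricted Lie superalgebra in $\mathrm{Ver}_4^+(k)$. Then the natural surjective algebra map $$\xi: SL/((\operatorname{Ker}D)^2)\longrightarrow \operatorname{gr}U_{\rm res}(L)$$ is an isomorphism.
   Context: $k$ is a field of characteristic $2$. $\mathrm{Ver}_4^+(k)$ is the symmetric tensor category of (possibly infinite dimensional) $k$-vector spaces $V$ with a linear map $D:V\to V$, $D^2=0$ (write $x'=Dx$); on $V\otimes W$, $D(v\otimes w)=v'\otimes w+v\otimes w'$; the braiding is $c(v\otimes w)=w\otimes v+w'\otimes v'$. An operadic Lie algebra in $\mathrm{Ver}_4^+(k)$ is an object $L$ with a $k$-bilinear bracket such that for all $x,y,z$: $[x,y]'=[x',y]+[x,y']$; $[x,y]=[y,x]+[y',x']$; and $[[x,y],z]+[[z,x],y]+[[y,z],x]+[[x',y],z']+[[z',x],y']+[[y',z],x']=0$. It is a Lie algebra if moreover $[x,x]=0$ whenever $x'=0$. A super-structure on $L$ is a pair of subspaces $\operatorname{Im}D\subset L_0,L_1\subset\operatorname{Ker}D$ with $L_0\cap L_1=\operatorname{Im}D$ and $L_0+L_1=\operatorname{Ker}D$. A map $Q$ between $k$-vector spaces is quadratic if $Q(\lambda y)=\lambda^2Q(y)$ for $\lambda \in k$ and $Q(y_1+y_2)-Q(y_1)-Q(y_2)$ is bilinear. A Lie superalgebra in $\mathrm{Ver}_4^+(k)$ is a Lie algebra $L$ in $\mathrm{Ver}_4^+(k)$ with a super-structure $L_0,L_1$ such that $[L_i,L_j]\subset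 L_{i+j}$ (indices mod $2$), and a quadratic map $Q:L_1\to L_0$ such that $Q(x')=[x,x]$ for $x\in L$; $Q(y_1+y_2)-Q(y_1)-Q(y_2)=[y_1,y_2]$ for $y_1,y_2\in L_1$; $[Q(y),x]=[y,[y,x]]$ for $y\in L_1$, $x\in L$. A restricted Lie superalgebra in $\mathrm{Ver}_4^+(k)$ is a Lie superalgebra $L$ in $\mathrm{Ver}_4^+(k)$ together with an extension of $Q:L_1\to L_0$ to a quadratic map $Q:\operatorname{Ker}D\to\operatorname{Ker}D$ which maps $L_0$ to $L_0$ and satisfies: $Q(x+y)-Q(x)-Q(y)=[x,y]$ for $x,y\in\operatorname{Ker}D$; $[Q(x),y]=[x,[x,y]]$ for $x\in L_0$, $y\in L$; and $[x,x]=Q(x')$ for $x\in L$. $U(L)$ is the quotient of the tensor algebra $TL$ by the two-sided ideal generated by $x\otimes y-y\otimes x-y'\otimes x'-[x,y]$, $x,y\in L$. $SL$ is the quotient of $TL$ by the two-sided ideal generated by $x\otimes y-y\otimes x-y'\otimes x'$. For $x\in\operatorname{Ker}D$ put $C(x):=x^2-Q(x)\in U(L)$. $U_{\rm res}(L):=U(L)/(C(x),\ x\in\operatorname{Ker}D)$, with the increasing filtration induced by degree in $TL$, and $\operatorname{gr}$ is the associated graded algebra. $SL/((\operatorname{Ker}D)^2)$ is the quotient of $SL$ by the two-sided ideal generated by the squares $x^2$, $x\in\operatorname{Ker}D$. The map $\xi$ is the algebra map induced by sending $x\in L$ to its class in degree $1$ of $\operatorname{gr}U_{\rm res}(L)$.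 *)

theory Defs
  imports
    Complex_Main
    "HOL-Algebra.QuotRing"
    "HOL-Algebra.Module"
    "HOL-Library.Poly_Mapping"
    "HOL-Library.FuncSet"
begin

section \<open>Lie superalgebras in \<open>Ver\<^sub>4\<^sup>+(k)\<close>\<close>

locale ver4p_object = vector_space scale
  for scale :: "'k::field \<Rightarrow> 'l::ab_group_add \<Rightarrow> 'l" (infixr \<open>*s\<close> 75) +
  fixes D :: "'l \<Rightarrow> 'l"
  assumes char_2: "CHAR('k) = 2"
    and linear_D: "Vector_Spaces.linear scale scale D"
    and D_D: "D (D x) = 0"
begin

definition Ker_D :: "'l set" where "Ker_D = {x. D x = 0}"

definition Im_D :: "'l set" where "Im_D = range D"

text \<open>Quadratic maps defined on a subspace \<open>V\<close>; values outside \<open>V\<close> are irrelevant.\<close>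
definition quadratic_on :: "'l set \<Rightarrow> ('l \<Rightarrow> 'l) \<Rightarrow> bool" where
  "quadratic_on V q \<longleftrightarrow>
     (\<forall>c. \<forall>y\<in>V. q (c *s y) = c\<^sup>2 *s q y) \<and>
     (let B = (\<lambda>y z. q (y + z) - q y - q z) in
        (\<forall>x\<in>V. \<forall>y\<in>V. \<forall>z\<in>V. B (x + y) z = B x z + B y z \<and> B x (y + z) = B x y + B x z) \<and>
        (\<forall>c. \<forall>y\<in>V. \<forall>z\<in>V. B (c *s y) z = c *s B y z \<and> B y (c *s z) = c *s B y z))"

end

locale operadic_lie_algebra_ver4p = ver4p_object +
  fixes br :: "'b \<Rightarrow> 'b \<Rightarrow> 'b"
  assumes linear_br_left: "Vector_Spaces.linear scale scale (\<lambda>x. br x y)"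
    and linear_br_right: "Vector_Spaces.linear scale scale (\<lambda>y. br x y)"
    and D_br: "D (br x y) = br (D x) y + br x (D y)"
    and br_commute: "br x y = br y x + br (D y) (D x)"
    and jacobi: "br (br x y) z + br (br z x) y + br (br y z) x
       + br (br (D x) y) (D z) + br (br (D z) x) (D y) + br (br (D y) z) (D x) = 0"

locale lie_algebra_ver4p = operadic_lie_algebra_ver4p +
  assumes br_self: "D x = 0 \<Longrightarrow> br x x = 0"

locale super_structure = ver4p_object +
  fixes L0 L1 :: "'b set"
  assumes subspace_L0: "subspace L0" and subspace_L1: "subspace L1"
    and L0_bounds: "Im_D \<subseteq> L0" "L0 \<subseteq> Ker_D"
    and L1_bounds: "Im_D \<subseteq> L1" "L1 \<subseteq> Ker_D"
    and L0_Int_L1: "L0 \<inter> L1 = Im_D"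
    and L0_plus_L1: "{y + z | y z. y \<in> L0 \<and> z \<in> L1} = Ker_D"

locale lie_superalgebra_ver4p =
  lie_algebra_ver4p scale D br + super_structure scale D L0 L1
  for scale :: "'k::field \<Rightarrow> 'l::ab_group_add \<Rightarrow> 'l" (infixr \<open>*s\<close> 75)
    and D :: "'l \<Rightarrow> 'l" and br :: "'l \<Rightarrow> 'l \<Rightarrow> 'l" and L0 L1 :: "'l set" +
  fixes Q :: "'l \<Rightarrow> 'l"
  assumes br_L0_L0: "x \<in> L0 \<Longrightarrow> y \<in> L0 \<Longrightarrow> br x y \<in> L0"
    and br_L0_L1: "x \<in> L0 \<Longrightarrow> y \<in> L1 \<Longrightarrow> br x y \<in> L1"
    and br_L1_L0: "x \<in> L1 \<Longrightarrow> y \<in> L0 \<Longrightarrow> br x y \<in> L1"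
    and br_L1_L1: "x \<in> L1 \<Longrightarrow> y \<in> L1 \<Longrightarrow> br x y \<in> L0"
    and Q_L1: "y \<in> L1 \<Longrightarrow> Q y \<in> L0"
    and quadratic_Q_L1: "quadratic_on L1 Q"
    and Q_D: "Q (D x) = br x x"
    and Q_polar_L1: "y \<in> L1 \<Longrightarrow> z \<in> L1 \<Longrightarrow> Q (y + z) - Q y - Q z = br y z"
    and br_Q_L1: "y \<in> L1 \<Longrightarrow> br (Q y) x = br y (br y x)"

text \<open>The single function \<open>Q\<close> stands both for the map on \<open>L1\<close> and for its extension to \<open>Ker D\<close>;
  its values outside \<open>Ker D\<close> play no role.\<close>
locale restricted_lie_superalgebra_ver4p = lie_superalgebra_ver4p +
  assumes Q_Ker_D: "x \<in> Ker_D \<Longrightarrow> Q x \<in> Ker_D"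
    and quadratic_Q_Ker_D: "quadratic_on Ker_D Q"
    and Q_L0: "x \<in> L0 \<Longrightarrow> Q x \<in> L0"
    and Q_polar: "x \<in> Ker_D \<Longrightarrow> y \<in> Ker_D \<Longrightarrow> Q (x + y) - Q x - Q y = br x y"
    and br_Q_L0: "x \<in> L0 \<Longrightarrow> br (Q x) y = br x (br x y)"
    and Q_D_restricted: "br x x = Q (D x)"


section \<open>Algebras over a field\<close>

text \<open>An associative unital algebra is a ring record with scalar multiplication, i.e. the record
  type \<^typ>\<open>('k, 'a) module\<close>.  A two-sided ring ideal of such an algebra is automatically closed
  under scalar multiplication.\<close>

definition quot_algebra :: "('k, 'a, 'm) module_scheme \<Rightarrow> 'a set \<Rightarrow> ('k, 'a set) module" where
  "quot_algebra A I =
     ring.extend (A Quot I) (module.fields (\<lambda>c X. \<Union>a\<in>X. I +>\<^bsub>A\<^esub> (c \<odot>\<^bsub>A\<^esub> a)))"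

definition algebra_hom ::
  "('k, 'a, 'm) module_scheme \<Rightarrow> ('k, 'b, 'n) module_scheme \<Rightarrow> ('a \<Rightarrow> 'b) set" where
  "algebra_hom A B =
     {h \<in> ring_hom A B. \<forall>c. \<forall>a\<in>carrier A. h (c \<odot>\<^bsub>A\<^esub> a) = c \<odot>\<^bsub>B\<^esub> h a}"

definition algebra_iso ::
  "('k, 'a, 'm) module_scheme \<Rightarrow> ('k, 'b, 'n) module_scheme \<Rightarrow> ('a \<Rightarrow> 'b) set" where
  "algebra_iso A B = {h \<in> algebra_hom A B. bij_betw h (carrier A) (carrier B)}"


subsection \<open>The associated graded algebra of a filtered algebra\<close>

text \<open>\<open>fil_below A F n\<close> is \<open>F\<^bsub>n-1\<^esub>\<close>, with \<open>F\<^bsub>-1\<^esub> = 0\<close>.\<close>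
definition fil_below :: "('a, 'm) ring_scheme \<Rightarrow> (nat \<Rightarrow> 'a set) \<Rightarrow> nat \<Rightarrow> 'a set" where
  "fil_below A F n = (case n of 0 \<Rightarrow> {\<zero>\<^bsub>A\<^esub>} | Suc m \<Rightarrow> F m)"

text \<open>The additive group \<open>F\<^sub>n / F\<^bsub>n-1\<^esub>\<close>, written as a multiplicative group record.\<close>
definition gr_piece :: "('a, 'm) ring_scheme \<Rightarrow> (nat \<Rightarrow> 'a set) \<Rightarrow> nat \<Rightarrow> 'a set monoid" where
  "gr_piece A F n =
     \<lparr>carrier = F n, monoid.mult = add A, one = \<zero>\<^bsub>A\<^esub>\<rparr> Mod fil_below A F n"

text \<open>The direct sum of the pieces, as finitely supported families.  The degree-\<open>n\<close> component of a
  product is the sum in \<open>F\<^sub>n / F\<^bsub>n-1\<^esub>\<close> (hence \<^const>\<open>finprod\<close>) over \<open>i + j = n\<close> of the products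
  \<open>F\<^sub>i / F\<^bsub>i-1\<^esub> \<times> F\<^sub>j / F\<^bsub>j-1\<^esub> \<rightarrow> F\<^sub>n / F\<^bsub>n-1\<^esub>\<close> induced by the multiplication of \<open>A\<close>.\<close>
definition gr_algebra ::
  "('k, 'a, 'm) module_scheme \<Rightarrow> (nat \<Rightarrow> 'a set) \<Rightarrow> ('k, nat \<Rightarrow> 'a set) module" where
  "gr_algebra A F =
     \<lparr>carrier = {g. (\<forall>n. g n \<in> carrier (gr_piece A F n)) \<and>
                    finite {n. g n \<noteq> \<one>\<^bsub>gr_piece A F n\<^esub>}},
      monoid.mult = (\<lambda>g h n.
        finprod (gr_piece A F n) (\<lambda>i. rcoset_mult A (fil_below A F n) (g i) (h (n - i))) {..n}),
      one = (\<lambda>n. if n = 0 then fil_below A F 0 +>\<^bsub>A\<^esub> \<one>\<^bsub>A\<^esub> else \<one>\<^bsub>gr_piece A F n\<^esub>),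
      zero = (\<lambda>n. \<one>\<^bsub>gr_piece A F n\<^esub>),
      add = (\<lambda>g h n. g n \<otimes>\<^bsub>gr_piece A F n\<^esub> h n),
      smult = (\<lambda>c g n. \<Union>a\<in>g n. fil_below A F n +>\<^bsub>A\<^esub> (c \<odot>\<^bsub>A\<^esub> a))\<rparr>"

text \<open>The class in degree \<open>n\<close> of an element \<open>a \<in> F\<^sub>n\<close>.\<close>
definition gr_class ::
  "('k, 'a, 'm) module_scheme \<Rightarrow> (nat \<Rightarrow> 'a set) \<Rightarrow> nat \<Rightarrow> 'a \<Rightarrow> (nat \<Rightarrow> 'a set)" where
  "gr_class A F n a =
     (\<lambda>m. if m = n then fil_below A F m +>\<^bsub>A\<^esub> a else \<one>\<^bsub>gr_piece A F m\<^esub>)"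


section \<open>The tensor algebra\<close>

text \<open>Lists as the free monoid, so that \<^typ>\<open>'l list \<Rightarrow>\<^sub>0 'k\<close> is the free associative \<open>k\<close>-algebra on
  the underlying set of \<open>L\<close>.\<close>
instantiation list :: (type) monoid_add
begin
definition zero_list :: "'a list" where "zero_list = []"
definition plus_list :: "'a list \<Rightarrow> 'a list \<Rightarrow> 'a list" where "plus_list = append"
instance by standard (simp_all add: zero_list_def plus_list_def)
end

definition word_algebra :: "('k::field, 'l list \<Rightarrow>\<^sub>0 'k) module" where
  "word_algebra =
     \<lparr>carrier = UNIV, monoid.mult = (*), one = 1, zero = 0, add = (+),
      smult = (\<lambda>c. Poly_Mapping.map ((*) c))\<rparr>"

text \<open>The word \<open>x\<^sub>1 \<dots> x\<^sub>n\<close> becomes \<open>x\<^sub>1 \<otimes> \<dots> \<otimes> x\<^sub>n\<close> in the tensor algebra.  The ideal generated by the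
  following elements is spanned by the multilinearity relations between words, so the degree-\<open>n\<close>
  part of the quotient is the \<open>n\<close>-th tensor power of \<open>L\<close> over \<open>k\<close>.\<close>
definition linearity_relations ::
  "('k::field \<Rightarrow> 'l::ab_group_add \<Rightarrow> 'l) \<Rightarrow> ('l list \<Rightarrow>\<^sub>0 'k) set" where
  "linearity_relations scale =
     {Poly_Mapping.single [x + y] 1 - Poly_Mapping.single [x] 1 - Poly_Mapping.single [y] 1
       | x y. True} \<union>
     {Poly_Mapping.single [scale c x] 1 - Poly_Mapping.single [x] c | c x. True}"

definition tensor_ideal ::
  "('k::field \<Rightarrow> 'l::ab_group_add \<Rightarrow> 'l) \<Rightarrow> ('l list \<Rightarrow>\<^sub>0 'k) set" where
  "tensor_ideal scale = Idl\<^bsub>word_algebra\<^esub> (linearity_relations scale)"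

definition tensor_algebra ::
  "('k::field \<Rightarrow> 'l::ab_group_add \<Rightarrow> 'l) \<Rightarrow> ('k, ('l list \<Rightarrow>\<^sub>0 'k) set) module" where
  "tensor_algebra scale = quot_algebra word_algebra (tensor_ideal scale)"

definition tensor_gen ::
  "('k::field \<Rightarrow> 'l::ab_group_add \<Rightarrow> 'l) \<Rightarrow> 'l \<Rightarrow> ('l list \<Rightarrow>\<^sub>0 'k) set" where
  "tensor_gen scale x =
     tensor_ideal scale +>\<^bsub>word_algebra\<^esub> Poly_Mapping.single [x] 1"

definition tensor_fil ::
  "('k::field \<Rightarrow> 'l::ab_group_add \<Rightarrow> 'l) \<Rightarrow> nat \<Rightarrow> ('l list \<Rightarrow>\<^sub>0 'k) set set" where
  "tensor_fil scale n =
     (\<lambda>f. tensor_ideal scale +>\<^bsub>word_algebra\<^esub> f) ` {f. \<forall>w\<in>Poly_Mapping.keys f. length w \<le> n}"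


section \<open>The symmetric algebra and its quotient by the squares of \<open>Ker D\<close>\<close>

definition sym_ideal ::
  "('k::field \<Rightarrow> 'l::ab_group_add \<Rightarrow> 'l) \<Rightarrow> ('l \<Rightarrow> 'l) \<Rightarrow> ('l list \<Rightarrow>\<^sub>0 'k) set set" where
  "sym_ideal scale D =
     (let T = tensor_algebra scale; t = tensor_gen scale in
      Idl\<^bsub>T\<^esub> {t x \<otimes>\<^bsub>T\<^esub> t y \<ominus>\<^bsub>T\<^esub> t y \<otimes>\<^bsub>T\<^esub> t x \<ominus>\<^bsub>T\<^esub> t (D y) \<otimes>\<^bsub>T\<^esub> t (D x) | x y. True})"

definition sym_algebra ::
  "('k::field \<Rightarrow> 'l::ab_group_add \<Rightarrow> 'l) \<Rightarrow> ('l \<Rightarrow> 'l) \<Rightarrow> ('k, ('l list \<Rightarrow>\<^sub>0 'k) set set) module" where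
  "sym_algebra scale D = quot_algebra (tensor_algebra scale) (sym_ideal scale D)"

definition sym_gen ::
  "('k::field \<Rightarrow> 'l::ab_group_add \<Rightarrow> 'l) \<Rightarrow> ('l \<Rightarrow> 'l) \<Rightarrow> 'l \<Rightarrow> ('l list \<Rightarrow>\<^sub>0 'k) set set" where
  "sym_gen scale D x = sym_ideal scale D +>\<^bsub>tensor_algebra scale\<^esub> tensor_gen scale x"

definition sym_res_ideal ::
  "('k::field \<Rightarrow> 'l::ab_group_add \<Rightarrow> 'l) \<Rightarrow> ('l \<Rightarrow> 'l) \<Rightarrow> ('l list \<Rightarrow>\<^sub>0 'k) set set set" where
  "sym_res_ideal scale D =
     Idl\<^bsub>sym_algebra scale D\<^esub> {sym_gen scale D x [^]\<^bsub>sym_algebra scale D\<^esub> (2::nat) | x. D x = 0}"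

definition sym_res_algebra ::
  "('k::field \<Rightarrow> 'l::ab_group_add \<Rightarrow> 'l) \<Rightarrow> ('l \<Rightarrow> 'l) \<Rightarrow> ('k, ('l list \<Rightarrow>\<^sub>0 'k) set set set) module"
  where
  "sym_res_algebra scale D = quot_algebra (sym_algebra scale D) (sym_res_ideal scale D)"

definition sym_res_gen ::
  "('k::field \<Rightarrow> 'l::ab_group_add \<Rightarrow> 'l) \<Rightarrow> ('l \<Rightarrow> 'l) \<Rightarrow> 'l \<Rightarrow> ('l list \<Rightarrow>\<^sub>0 'k) set set set" where
  "sym_res_gen scale D x = sym_res_ideal scale D +>\<^bsub>sym_algebra scale D\<^esub> sym_gen scale D x"


section \<open>The (restricted) enveloping algebra\<close>

definition env_ideal ::
  "('k::field \<Rightarrow> 'l::ab_group_add \<Rightarrow> 'l) \<Rightarrow> ('l \<Rightarrow> 'l) \<Rightarrow> ('l \<Rightarrow> 'l \<Rightarrow> 'l)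
     \<Rightarrow> ('l list \<Rightarrow>\<^sub>0 'k) set set" where
  "env_ideal scale D br =
     (let T = tensor_algebra scale; t = tensor_gen scale in
      Idl\<^bsub>T\<^esub> {t x \<otimes>\<^bsub>T\<^esub> t y \<ominus>\<^bsub>T\<^esub> t y \<otimes>\<^bsub>T\<^esub> t x \<ominus>\<^bsub>T\<^esub> t (D y) \<otimes>\<^bsub>T\<^esub> t (D x) \<ominus>\<^bsub>T\<^esub> t (br x y) | x y. True})"

definition env_algebra ::
  "('k::field \<Rightarrow> 'l::ab_group_add \<Rightarrow> 'l) \<Rightarrow> ('l \<Rightarrow> 'l) \<Rightarrow> ('l \<Rightarrow> 'l \<Rightarrow> 'l)
     \<Rightarrow> ('k, ('l list \<Rightarrow>\<^sub>0 'k) set set) module" where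
  "env_algebra scale D br = quot_algebra (tensor_algebra scale) (env_ideal scale D br)"

definition env_gen ::
  "('k::field \<Rightarrow> 'l::ab_group_add \<Rightarrow> 'l) \<Rightarrow> ('l \<Rightarrow> 'l) \<Rightarrow> ('l \<Rightarrow> 'l \<Rightarrow> 'l)
     \<Rightarrow> 'l \<Rightarrow> ('l list \<Rightarrow>\<^sub>0 'k) set set" where
  "env_gen scale D br x = env_ideal scale D br +>\<^bsub>tensor_algebra scale\<^esub> tensor_gen scale x"

text \<open>The element \<open>C(x) = x\<^sup>2 - Q(x)\<close> of the enveloping algebra.\<close>
definition env_C ::
  "('k::field \<Rightarrow> 'l::ab_group_add \<Rightarrow> 'l) \<Rightarrow> ('l \<Rightarrow> 'l) \<Rightarrow> ('l \<Rightarrow> 'l \<Rightarrow> 'l) \<Rightarrow> ('l \<Rightarrow> 'l)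
     \<Rightarrow> 'l \<Rightarrow> ('l list \<Rightarrow>\<^sub>0 'k) set set" where
  "env_C scale D br Q x =
     (let U = env_algebra scale D br; u = env_gen scale D br in
      u x [^]\<^bsub>U\<^esub> (2::nat) \<ominus>\<^bsub>U\<^esub> u (Q x))"

definition res_ideal ::
  "('k::field \<Rightarrow> 'l::ab_group_add \<Rightarrow> 'l) \<Rightarrow> ('l \<Rightarrow> 'l) \<Rightarrow> ('l \<Rightarrow> 'l \<Rightarrow> 'l) \<Rightarrow> ('l \<Rightarrow> 'l)
     \<Rightarrow> ('l list \<Rightarrow>\<^sub>0 'k) set set set" where
  "res_ideal scale D br Q = Idl\<^bsub>env_algebra scale D br\<^esub> {env_C scale D br Q x | x. D x = 0}"

definition res_env_algebra ::
  "('k::field \<Rightarrow> 'l::ab_group_add \<Rightarrow> 'l) \<Rightarrow> ('l \<Rightarrow> 'l) \<Rightarrow> ('l \<Rightarrow> 'l \<Rightarrow> 'l) \<Rightarrow> ('l \<Rightarrow> 'l)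
     \<Rightarrow> ('k, ('l list \<Rightarrow>\<^sub>0 'k) set set set) module" where
  "res_env_algebra scale D br Q = quot_algebra (env_algebra scale D br) (res_ideal scale D br Q)"

definition res_env_gen ::
  "('k::field \<Rightarrow> 'l::ab_group_add \<Rightarrow> 'l) \<Rightarrow> ('l \<Rightarrow> 'l) \<Rightarrow> ('l \<Rightarrow> 'l \<Rightarrow> 'l) \<Rightarrow> ('l \<Rightarrow> 'l)
     \<Rightarrow> 'l \<Rightarrow> ('l list \<Rightarrow>\<^sub>0 'k) set set set" where
  "res_env_gen scale D br Q x =
     res_ideal scale D br Q +>\<^bsub>env_algebra scale D br\<^esub> env_gen scale D br x"

text \<open>The image of the degree filtration under \<open>TL \<rightarrow> U(L) \<rightarrow> U\<^bsub>res\<^esub>(L)\<close>.\<close>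
definition res_env_fil ::
  "('k::field \<Rightarrow> 'l::ab_group_add \<Rightarrow> 'l) \<Rightarrow> ('l \<Rightarrow> 'l) \<Rightarrow> ('l \<Rightarrow> 'l \<Rightarrow> 'l) \<Rightarrow> ('l \<Rightarrow> 'l)
     \<Rightarrow> nat \<Rightarrow> ('l list \<Rightarrow>\<^sub>0 'k) set set set set" where
  "res_env_fil scale D br Q n =
     (\<lambda>t. res_ideal scale D br Q +>\<^bsub>env_algebra scale D br\<^esub>
            (env_ideal scale D br +>\<^bsub>tensor_algebra scale\<^esub> t)) ` tensor_fil scale n"

definition gr_res_env ::
  "('k::field \<Rightarrow> 'l::ab_group_add \<Rightarrow> 'l) \<Rightarrow> ('l \<Rightarrow> 'l) \<Rightarrow> ('l \<Rightarrow> 'l \<Rightarrow> 'l) \<Rightarrow> ('l \<Rightarrow> 'l)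
     \<Rightarrow> ('k, nat \<Rightarrow> ('l list \<Rightarrow>\<^sub>0 'k) set set set set) module" where
  "gr_res_env scale D br Q =
     gr_algebra (res_env_algebra scale D br Q) (res_env_fil scale D br Q)"

text \<open>\<open>\<xi>\<close> is the algebra map sending the generator \<open>x \<in> L\<close> to its class in degree 1.  Extensionality
  (a fixed value outside the carrier) makes \<open>\<xi>\<close> unique as a HOL function.\<close>
definition is_natural_map ::
  "('k::field \<Rightarrow> 'l::ab_group_add \<Rightarrow> 'l) \<Rightarrow> ('l \<Rightarrow> 'l) \<Rightarrow> ('l \<Rightarrow> 'l \<Rightarrow> 'l) \<Rightarrow> ('l \<Rightarrow> 'l)
     \<Rightarrow> (('l list \<Rightarrow>\<^sub>0 'k) set set set \<Rightarrow> nat \<Rightarrow> ('l list \<Rightarrow>\<^sub>0 'k) set set set set) \<Rightarrow> bool" where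
  "is_natural_map scale D br Q \<xi> \<longleftrightarrow>
     \<xi> \<in> algebra_hom (sym_res_algebra scale D) (gr_res_env scale D br Q) \<and>
     \<xi> \<in> extensional (carrier (sym_res_algebra scale D)) \<and>
     (\<forall>x. \<xi> (sym_res_gen scale D x) =
        gr_class (res_env_algebra scale D br Q) (res_env_fil scale D br Q) 1
          (res_env_gen scale D br Q x))"

end

theory Submission
  imports Defs "HOL-Library.Multiset"
begin

text \<open>
The theorem is a Poincare--Birkhoff--Witt theorem, and the proof is a diamond-lemma argument
organised around leading terms.  All algebras in sight are quotients of the free algebra \<open>W\<close> on the
set \<open>L\<close>: \<open>SL/((Ker D)\<^sup>2)\<close> is \<open>W\<close> modulo the two-sided ideal \<open>J_sym\<close> of the multilinearity relations
and the elements \<open>xy - yx - y'x'\<close> and \<open>x\<^sup>2\<close> (\<open>x' = 0\<close>), while \<open>U\<^sub>r\<^sub>e\<^sub>s(L)\<close> is \<open>W\<close> modulo the ideal \<open>J_env\<close> of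
their inhomogeneous deformations \<open>xy - yx - y'x' - [x,y]\<close> and \<open>x\<^sup>2 - Q(x)\<close>.  The graded algebra of
\<open>W/J_env\<close> is \<open>W\<close> modulo the ideal of elements whose homogeneous components are leading terms of
elements of \<open>J_env\<close> (\<open>gr_presentation\<close>).  Two quotients of \<open>W\<close> by the same ideal are isomorphic by a
unique map compatible with the generators (\<open>presentation_iso\<close>), so everything reduces to the
equality \<open>leading_terms\<close>: the leading terms of \<open>J_env\<close> are exactly the elements of \<open>J_sym\<close>.

That elements of \<open>J_sym\<close> are leading terms is clear from the generators.  For the converse one needs a
linear map \<open>nf\<close> on \<open>W\<close> that kills \<open>J_env\<close>, does not raise the degree, and satisfies
\<open>nf f \<equiv> f\<close> modulo \<open>J_sym\<close> and terms of lower degree: if \<open>f\<close> is homogeneous of degree \<open>n\<close> and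
\<open>f \<equiv> j\<close> modulo degree \<open>< n\<close> with \<open>j \<in> J_env\<close>, then \<open>nf f = nf (f - j)\<close> has degree \<open>< n\<close>, so \<open>f\<close> lies in
\<open>J_sym\<close> up to lower degree, hence in \<open>J_sym\<close>, which is homogeneous.

The map \<open>nf\<close> rewrites every letter in a totally ordered basis \<open>B\<close> of \<open>L\<close> containing a basis of \<open>Ker D\<close> and
with \<open>D B \<subseteq> B \<union> {0}\<close>, and then straightens words over \<open>B\<close>: a descent \<open>xy\<close> (\<open>y \<prec> x\<close>) is replaced by
\<open>yx + y'x' + [x,y]\<close>, and \<open>xx\<close> with \<open>x' = 0\<close> by \<open>Q(x)\<close>.  Straightening terminates because it decreases,
lexicographically, the length, the number of letters outside \<open>Ker D\<close>, and the number of inversions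
of a word; note that \<open>y'x'\<close> has the length of \<open>xy\<close> but lies entirely in \<open>Ker D\<close>.  It is well defined
because two ways of reducing a word differ by relations attached to smaller words
(\<open>linear_confluence\<close>).  For disjoint positions this is formal.  For the overlaps \<open>xyz\<close>, \<open>xxz\<close>, \<open>xyy\<close>
and \<open>xxx\<close> it comes down to two identities in \<open>W\<close>: \<open>R_overlap\<close>, which is the Jacobi identity, and
\<open>q_overlap\<close>, which is \<open>[Q(x),z] = [x,[x,z]]\<close> for \<open>x' = 0\<close>.  The super-structure enters through
the last formula, which holds on \<open>L\<^sub>0\<close> and \<open>L\<^sub>1\<close> by assumption and on \<open>Ker D = L\<^sub>0 + L\<^sub>1\<close> by polarization.
\<close>

section \<open>The free algebra on words\<close>

abbreviation word :: "'l list \<Rightarrow> ('l list \<Rightarrow>\<^sub>0 'k::field)" where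
  "word w \<equiv> Poly_Mapping.single w 1"

abbreviation const :: "'k \<Rightarrow> ('l list \<Rightarrow>\<^sub>0 'k::field)" where
  "const c \<equiv> Poly_Mapping.single [] c"

lemma single_mult_single:
  "Poly_Mapping.single u c * Poly_Mapping.single v d = Poly_Mapping.single (u @ v) (c * d)"
  for c d :: "'k::field"
  by (simp add: mult_single plus_list_def)

lemma word_Nil: "word [] = 1"
  by (metis single_one zero_list_def)

lemma smult_eq_const_mult: "Poly_Mapping.map ((*) c) f = const c * f"
  for f :: "'l list \<Rightarrow>\<^sub>0 'k::field"
  by (simp add: mult_map_scale_conv_mult zero_list_def)

lemma free_induct [case_names zero add]:
  fixes f :: "'l list \<Rightarrow>\<^sub>0 'k::field"
  assumes "P 0" and step: "\<And>w c f. P f \<Longrightarrow> w \<notin> Poly_Mapping.keys f \<Longrightarrow> c \<noteq> 0 \<Longrightarrow> P (Poly_Mapping.single w c + f)"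
  shows "P f"
proof (induction f rule: update_induct)
  case const
  then show ?case using assms(1) by simp
next
  case (update f a b)
  have "Poly_Mapping.update a b f = Poly_Mapping.single a b + f"
    using update(1) by (intro poly_mapping_eqI) (auto simp: lookup_update lookup_add lookup_single in_keys_iff when_def)
  then show ?case using update step by simp
qed

lemma const_central: "const c * f = f * const c"
  for f :: "'l list \<Rightarrow>\<^sub>0 'k::field"
  by (induction f rule: free_induct) (simp_all add: distrib_left distrib_right single_mult_single mult.commute)

lemma const_left_commute: "f * (const c * g) = const c * (f * g)"
  for f :: "'l list \<Rightarrow>\<^sub>0 'k::field"
  by (metis const_central mult.assoc)

lemma const_mult_const: "const c * (const d * f) = const (c * d) * f"
  for f :: "'l list \<Rightarrow>\<^sub>0 'k::field"
  by (simp add: mult.assoc [symmetric] single_mult_single)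

lemma lookup_const_mult: "Poly_Mapping.lookup (const c * f) w = c * Poly_Mapping.lookup f w"
  for f :: "'l list \<Rightarrow>\<^sub>0 'k::field"
  by (simp add: smult_eq_const_mult [symmetric] map.rep_eq when_def)

lemma single_eq_const_word: "Poly_Mapping.single w c = const c * word w"
  for c :: "'k::field"
  by (simp add: single_mult_single)


subsection \<open>Additive spans\<close>

text \<open>The generating sets that occur are closed under scalars, so their additive spans are subspaces.\<close>

inductive_set additive_span :: "'a::comm_monoid_add set \<Rightarrow> 'a set" for S where
  zero: "0 \<in> additive_span S"
| add: "s \<in> S \<Longrightarrow> f \<in> additive_span S \<Longrightarrow> s + f \<in> additive_span S"

lemma additive_span_base: "s \<in> S \<Longrightarrow> s \<in> additive_span S"
  using additive_span.add [OF _ additive_span.zero] by fastforce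

lemma additive_span_plus: "f \<in> additive_span S \<Longrightarrow> g \<in> additive_span S \<Longrightarrow> f + g \<in> additive_span S"
  by (induction f rule: additive_span.induct) (auto simp: add.assoc intro: additive_span.intros)

lemma additive_span_image:
  assumes "f \<in> additive_span S" "h 0 = 0" "\<And>x y. h (x + y) = h x + h y"
    and "\<And>s. s \<in> S \<Longrightarrow> h s \<in> additive_span T"
  shows "h f \<in> additive_span T"
  using assms(1) by induction (auto simp: assms intro: additive_span.zero additive_span_plus)


subsection \<open>Linear extension of maps on words\<close>

definition linext :: "('l list \<Rightarrow> ('m list \<Rightarrow>\<^sub>0 'k::field)) \<Rightarrow> ('l list \<Rightarrow>\<^sub>0 'k) \<Rightarrow> ('m list \<Rightarrow>\<^sub>0 'k)" where
  "linext \<phi> f = (\<Sum>w\<in>Poly_Mapping.keys f. const (Poly_Mapping.lookup f w) * \<phi> w)"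

lemma linext_superset:
  assumes "finite X" "Poly_Mapping.keys f \<subseteq> X"
  shows "linext \<phi> f = (\<Sum>w\<in>X. const (Poly_Mapping.lookup f w) * \<phi> w)"
  unfolding linext_def using assms by (intro sum.mono_neutral_left) (auto simp: in_keys_iff)

lemma linext_zero [simp]: "linext \<phi> 0 = 0"
  by (simp add: linext_def)

lemma linext_add: "linext \<phi> (f + g) = linext \<phi> f + linext \<phi> g"
proof -
  let ?X = "Poly_Mapping.keys f \<union> Poly_Mapping.keys g"
  have "linext \<phi> (f + g) = (\<Sum>w\<in>?X. const (Poly_Mapping.lookup (f + g) w) * \<phi> w)"
    using Poly_Mapping.keys_add [of f g] by (intro linext_superset) auto
  also have "\<dots> = (\<Sum>w\<in>?X. const (Poly_Mapping.lookup f w) * \<phi> w) + (\<Sum>w\<in>?X. const (Poly_Mapping.lookup g w) * \<phi> w)"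
    by (simp add: lookup_add single_add distrib_right sum.distrib)
  finally show ?thesis by (simp add: linext_superset [of ?X])
qed

lemma linext_single: "linext \<phi> (Poly_Mapping.single w c) = const c * \<phi> w"
  by (cases "c = 0") (simp_all add: linext_def)

lemma linext_word [simp]: "linext \<phi> (word w) = \<phi> w"
  by (simp add: linext_single word_Nil)

lemma linext_const_mult: "linext \<phi> (const c * f) = const c * linext \<phi> f"
  by (induction f rule: free_induct)
    (simp_all add: linext_add distrib_left single_mult_single linext_single const_mult_const)

lemma linext_uminus: "linext \<phi> (- f) = - linext \<phi> f"
  by (metis add_eq_0_iff linext_add linext_zero)

lemma linext_diff: "linext \<phi> (f - g) = linext \<phi> f - linext \<phi> g"
  by (metis linext_add linext_uminus diff_conv_add_uminus)

lemma linext_sum: "linext \<phi> (sum f I) = (\<Sum>i\<in>I. linext \<phi> (f i))"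
  by (induction I rule: infinite_finite_induct) (simp_all add: linext_add)

lemma linext_mult:
  assumes "\<And>u v. \<phi> (u @ v) = \<phi> u * \<phi> v"
  shows "linext \<phi> (f * g) = linext \<phi> f * linext \<phi> g"
proof (induction f rule: free_induct)
  case zero
  then show ?case by simp
next
  case (add w c f)
  have "linext \<phi> (Poly_Mapping.single w c * g) = linext \<phi> (Poly_Mapping.single w c) * linext \<phi> g"
  proof (induction g rule: free_induct)
    case zero
    then show ?case by simp
  next
    case (add v d g)
    have "linext \<phi> (Poly_Mapping.single w c * Poly_Mapping.single v d)
        = const c * (const d * (\<phi> w * \<phi> v))"
      by (simp only: single_mult_single linext_single assms const_mult_const)
    also have "const d * (\<phi> w * \<phi> v) = \<phi> w * (const d * \<phi> v)"
      by (rule const_left_commute [symmetric])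
    also have "const c * \<dots> = linext \<phi> (Poly_Mapping.single w c) * linext \<phi> (Poly_Mapping.single v d)"
      by (simp only: linext_single mult.assoc)
    finally show ?case using add by (simp only: distrib_left linext_add)
  qed
  with add show ?case by (simp only: distrib_right linext_add)
qed


subsection \<open>The length grading\<close>

definition words_below :: "nat \<Rightarrow> ('l list \<Rightarrow>\<^sub>0 'k::field) set" where
  "words_below n = {f. \<forall>w\<in>Poly_Mapping.keys f. length w < n}"

definition component :: "nat \<Rightarrow> ('l list \<Rightarrow>\<^sub>0 'k::field) \<Rightarrow> ('l list \<Rightarrow>\<^sub>0 'k)" where
  "component n = linext (\<lambda>w. if length w = n then word w else 0)"

lemma words_below_0 [simp]: "words_below 0 = {0}"
  by (auto simp: words_below_def)

lemma zero_in_words_below [simp]: "0 \<in> words_below n"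
  by (simp add: words_below_def)

lemma words_below_add: "f \<in> words_below n \<Longrightarrow> g \<in> words_below n \<Longrightarrow> f + g \<in> words_below n"
  using Poly_Mapping.keys_add [of f g] by (auto simp: words_below_def)

lemma keys_const_mult: "Poly_Mapping.keys (const c * f) \<subseteq> Poly_Mapping.keys f"
  for f :: "'l list \<Rightarrow>\<^sub>0 'k::field"
  by (auto simp: in_keys_iff lookup_const_mult)

lemma words_below_const_mult: "f \<in> words_below n \<Longrightarrow> const c * f \<in> words_below n"
  using keys_const_mult [of c f] by (auto simp: words_below_def)

lemma words_below_uminus: "f \<in> words_below n \<Longrightarrow> - f \<in> words_below n"
  by (auto simp: words_below_def in_keys_iff)

lemma words_below_mono: "f \<in> words_below m \<Longrightarrow> m \<le> n \<Longrightarrow> f \<in> words_below n"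
  by (auto simp: words_below_def)

lemma words_below_single [simp]: "length w < n \<Longrightarrow> Poly_Mapping.single w c \<in> words_below n"
  by (cases "c = 0") (simp_all add: words_below_def)

text \<open>With \<open>words_below n\<close> standing for degree \<open>< n\<close>, degrees add up to \<open>m - 1 + n - 1\<close>.\<close>

lemma words_below_mult:
  "f \<in> words_below m \<Longrightarrow> g \<in> words_below n \<Longrightarrow> f * g \<in> words_below (m + n - 1)"
proof -
  assume fg: "f \<in> words_below m" "g \<in> words_below n"
  show ?thesis unfolding words_below_def
  proof safe
    fix w assume "w \<in> Poly_Mapping.keys (f * g)"
    then obtain u v where "u \<in> Poly_Mapping.keys f" "v \<in> Poly_Mapping.keys g" "w = u + v"
      using Poly_Mapping.keys_mult [of f g] by auto
    then have "length u < m" "length v < n" "length w = length u + length v"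
      using fg by (auto simp: words_below_def plus_list_def)
    then show "length w < m + n - 1" by simp
  qed
qed

lemma words_below_linext:
  assumes "\<And>w. w \<in> Poly_Mapping.keys f \<Longrightarrow> \<phi> w \<in> words_below n"
  shows "linext \<phi> f \<in> words_below n"
proof -
  have "(\<Sum>w\<in>X. const (Poly_Mapping.lookup f w) * \<phi> w) \<in> words_below n" if "X \<subseteq> Poly_Mapping.keys f" for X
    using finite_subset [OF that finite_keys] that
    by (induction X rule: finite_induct) (auto intro!: words_below_add words_below_const_mult assms)
  then show ?thesis by (simp add: linext_def)
qed

lemma component_zero [simp]: "component n 0 = 0"
  and component_add: "component n (f + g) = component n f + component n g"
  and component_diff: "component n (f - g) = component n f - component n g"
  and component_const_mult: "component n (const c * f) = const c * component n f"
  by (simp_all add: component_def linext_add linext_diff linext_uminus linext_const_mult)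

lemma component_sum: "component n (sum f I) = (\<Sum>i\<in>I. component n (f i))"
  by (simp add: component_def linext_sum)

lemma component_single:
  "component n (Poly_Mapping.single w c) = (if length w = n then Poly_Mapping.single w c else 0)"
  by (simp add: component_def linext_single single_mult_single)

lemma lookup_component: "Poly_Mapping.lookup (component n f) w = (if length w = n then Poly_Mapping.lookup f w else 0)"
  by (induction f rule: free_induct)
    (auto simp: component_add component_single lookup_add lookup_single when_def)

lemma component_words_below [simp]: "n < m \<Longrightarrow> component n f \<in> words_below m"
  by (auto simp: words_below_def in_keys_iff lookup_component split: if_splits)

lemma component_eq_0: "f \<in> words_below n \<Longrightarrow> n \<le> m \<Longrightarrow> component m f = 0"
  by (rule poly_mapping_eqI) (force simp: lookup_component words_below_def in_keys_iff)

lemma component_component: "component m (component n f) = (if m = n then component n f else 0)"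
  by (rule poly_mapping_eqI) (simp add: lookup_component)

lemma minus_component_words_below:
  "f \<in> words_below (Suc n) \<Longrightarrow> f - component n f \<in> words_below n"
  unfolding words_below_def
  by (auto simp: in_keys_iff lookup_component lookup_minus less_Suc_eq split: if_splits)

lemma exists_words_below: "\<exists>n. f \<in> words_below n"
proof (intro exI)
  show "f \<in> words_below (Suc (Max (length ` Poly_Mapping.keys f)))"
    by (auto simp: words_below_def less_Suc_eq_le)
qed

lemma sum_component: "f \<in> words_below n \<Longrightarrow> (\<Sum>i<n. component i f) = f"
  by (rule poly_mapping_eqI)
    (force simp: lookup_sum lookup_component words_below_def in_keys_iff sum.delta)

lemma component_mult: "component n (f * g) = (\<Sum>i\<le>n. component i f * component (n - i) g)"
proof (induction f rule: free_induct)
  case zero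
  then show ?case by simp
next
  case (add w c f)
  have "component n (Poly_Mapping.single w c * g)
      = (\<Sum>i\<le>n. component i (Poly_Mapping.single w c) * component (n - i) g)"
  proof -
    have "(\<Sum>i\<le>n. component i (Poly_Mapping.single w c) * component (n - i) g)
        = (if length w \<le> n then Poly_Mapping.single w c * component (n - length w) g else 0)"
    proof -
      have "(\<Sum>i\<le>n. component i (Poly_Mapping.single w c) * component (n - i) g)
          = (\<Sum>i\<le>n. if i = length w then Poly_Mapping.single w c * component (n - i) g else 0)"
        by (intro sum.cong refl) (simp add: component_single)
      then show ?thesis by (simp add: sum.delta)
    qed
    also have "\<dots> = component n (Poly_Mapping.single w c * g)"
      by (induction g rule: free_induct)
        (auto simp: component_add distrib_left component_single single_mult_single)
    finally show ?thesis ..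
  qed
  with add show ?case
    by (simp add: distrib_right component_add sum.distrib)
qed


subsection \<open>Two-sided ideals\<close>

text \<open>Ideals are described as spans, rather than as intersections, because linear maps that are not
multiplicative have to be evaluated on them.\<close>

definition two_sided :: "('l list \<Rightarrow>\<^sub>0 'k::field) set \<Rightarrow> ('l list \<Rightarrow>\<^sub>0 'k) set" where
  "two_sided S = additive_span {Poly_Mapping.single u c * s * word v | u c s v. s \<in> S}"

lemma two_sided_zero [simp]: "0 \<in> two_sided S"
  by (simp add: two_sided_def additive_span.zero)

lemma two_sided_add: "f \<in> two_sided S \<Longrightarrow> g \<in> two_sided S \<Longrightarrow> f + g \<in> two_sided S"
  by (simp add: two_sided_def additive_span_plus)

lemma two_sided_gen: "s \<in> S \<Longrightarrow> Poly_Mapping.single u c * s * word v \<in> two_sided S"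
  unfolding two_sided_def by (intro additive_span_base) auto

lemma two_sided_base: "s \<in> S \<Longrightarrow> s \<in> two_sided S"
  using two_sided_gen [of s S "[]" 1 "[]"] by (simp add: word_Nil)

lemma two_sided_mult_left: "f \<in> two_sided S \<Longrightarrow> h * f \<in> two_sided S"
proof (induction h rule: free_induct)
  case zero
  then show ?case by simp
next
  case (add w d h)
  have "Poly_Mapping.single w d * f \<in> two_sided S"
    using add.prems unfolding two_sided_def
  proof (rule additive_span_image)
    fix s assume "s \<in> {Poly_Mapping.single u c * s * word v | u c s v. s \<in> S}"
    then obtain u c t v where "s = Poly_Mapping.single u c * t * word v" "t \<in> S" by auto
    then have "Poly_Mapping.single w d * s = Poly_Mapping.single (w @ u) (d * c) * t * word v"
      by (simp add: mult.assoc [symmetric] single_mult_single)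
    then show "Poly_Mapping.single w d * s
        \<in> additive_span {Poly_Mapping.single u c * s * word v | u c s v. s \<in> S}"
      using two_sided_gen [OF \<open>t \<in> S\<close>] by (simp add: two_sided_def)
  qed (simp_all add: distrib_left)
  with add show ?case by (simp add: distrib_right two_sided_add)
qed

lemma two_sided_mult_right: "f \<in> two_sided S \<Longrightarrow> f * h \<in> two_sided S"
proof (induction h rule: free_induct)
  case zero
  then show ?case by simp
next
  case (add w d h)
  have "f * Poly_Mapping.single w d \<in> two_sided S"
    using add.prems unfolding two_sided_def
  proof (rule additive_span_image)
    fix s assume "s \<in> {Poly_Mapping.single u c * s * word v | u c s v. s \<in> S}"
    then obtain u c t v where s: "s = Poly_Mapping.single u c * t * word v" and "t \<in> S" by auto
    have "s * Poly_Mapping.single w d = Poly_Mapping.single u c * t * Poly_Mapping.single (v @ w) d"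
      by (simp add: s mult.assoc single_mult_single)
    also have "\<dots> = const d * (Poly_Mapping.single u c * t * word (v @ w))"
      by (subst single_eq_const_word) (rule const_left_commute)
    also have "\<dots> = Poly_Mapping.single u (d * c) * t * word (v @ w)"
      by (simp add: mult.assoc [symmetric] single_mult_single)
    finally show "s * Poly_Mapping.single w d
        \<in> additive_span {Poly_Mapping.single u c * s * word v | u c s v. s \<in> S}"
      using two_sided_gen [OF \<open>t \<in> S\<close>] by (simp add: two_sided_def)
  qed (simp_all add: distrib_right)
  with add show ?case by (simp add: distrib_left two_sided_add)
qed

lemma two_sided_uminus: "f \<in> two_sided S \<Longrightarrow> - f \<in> two_sided S"
  using two_sided_mult_left [of f S "- 1"] by simp

lemma two_sided_least:
  assumes "f \<in> two_sided S" "0 \<in> I" "\<And>x y. x \<in> I \<Longrightarrow> y \<in> I \<Longrightarrow> x + y \<in> I"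
    and "\<And>u c s v. s \<in> S \<Longrightarrow> Poly_Mapping.single u c * s * word v \<in> I"
  shows "f \<in> I"
  using assms(1) unfolding two_sided_def by induction (auto intro: assms)

lemma two_sided_mono: "S \<subseteq> two_sided T \<Longrightarrow> two_sided S \<subseteq> two_sided T"
  by (rule subsetI, erule two_sided_least)
    (blast intro: two_sided_add two_sided_mult_left two_sided_mult_right two_sided_zero)+

lemma two_sided_empty: "two_sided {} = {0}"
proof
  show "two_sided {} \<subseteq> {0}" by (rule subsetI, erule two_sided_least) simp_all
qed simp


section \<open>Presentations of algebras by words\<close>

text \<open>An algebra given as a quotient \<open>p\<close> of the free algebra with kernel \<open>J\<close>.  The ring axioms form a
separate locale: for an associated graded algebra they are a consequence of being such a quotient.\<close>

locale algebra_presentation =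
  fixes A :: "('k::field, 'a) module" (structure)
    and p :: "('l list \<Rightarrow>\<^sub>0 'k) \<Rightarrow> 'a"
    and J :: "('l list \<Rightarrow>\<^sub>0 'k) set"
  assumes range_p: "range p = carrier A"
    and p_add: "p (f + g) = p f \<oplus> p g"
    and p_mult: "p (f * g) = p f \<otimes> p g"
    and p_one: "p 1 = \<one>"
    and p_const_mult: "p (const c * f) = c \<odot> p f"
    and p_eq_iff: "p f = p g \<longleftrightarrow> f - g \<in> J"
begin

lemma p_closed [simp]: "p f \<in> carrier A"
  using range_p by blast

lemma carrier_cases: "a \<in> carrier A \<Longrightarrow> \<exists>f. a = p f"
  using range_p by blast

end

text \<open>The isomorphism sends \<open>p f\<close> to \<open>q f\<close>.  It is unique because the letters generate the free algebra.\<close>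

lemma presentation_iso:
  fixes p :: "('l list \<Rightarrow>\<^sub>0 'k::field) \<Rightarrow> 'a" and q :: "('l list \<Rightarrow>\<^sub>0 'k) \<Rightarrow> 'b"
  assumes "algebra_presentation A p J" and "algebra_presentation B q J"
  defines "natural \<xi> \<equiv> \<xi> \<in> algebra_hom A B \<and> \<xi> \<in> extensional (carrier A) \<and>
    (\<forall>x. \<xi> (p (word [x])) = q (word [x]))"
  shows "(\<exists>!\<xi>. natural \<xi>) \<and> (\<forall>\<xi>. natural \<xi> \<longrightarrow> \<xi> \<in> algebra_iso A B)"
proof -
  interpret A: algebra_presentation A p J by fact
  interpret B: algebra_presentation B q J by fact
  have same: "p f = p g \<longleftrightarrow> q f = q g" for f g
    by (simp add: A.p_eq_iff B.p_eq_iff)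
  define \<xi> where "\<xi> a = (if a \<in> carrier A then q (SOME f. p f = a) else undefined)" for a
  have \<xi>: "\<xi> (p f) = q f" for f
    unfolding \<xi>_def using same someI [of "\<lambda>g. p g = p f" f] by simp
  have hom: "\<xi> \<in> algebra_hom A B"
    unfolding algebra_hom_def ring_hom_def
    by (auto dest!: A.carrier_cases simp: \<xi> A.p_add [symmetric] B.p_add [symmetric]
        A.p_mult [symmetric] B.p_mult [symmetric] A.p_one [symmetric] B.p_one [symmetric]
        A.p_const_mult [symmetric] B.p_const_mult [symmetric])
  have nat: "natural \<xi>"
    using hom by (auto simp: natural_def \<xi> extensional_def) (simp add: \<xi>_def)
  have determined: "\<eta> (p f) = q f" if "natural \<eta>" for \<eta> f
  proof -
    have \<eta>: "\<eta> (p f \<otimes>\<^bsub>A\<^esub> p g) = \<eta> (p f) \<otimes>\<^bsub>B\<^esub> \<eta> (p g)" "\<eta> (p f \<oplus>\<^bsub>A\<^esub> p g) = \<eta> (p f) \<oplus>\<^bsub>B\<^esub> \<eta> (p g)"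
      "\<eta> \<one>\<^bsub>A\<^esub> = \<one>\<^bsub>B\<^esub>" "\<eta> (c \<odot>\<^bsub>A\<^esub> p f) = c \<odot>\<^bsub>B\<^esub> \<eta> (p f)"
      "\<eta> (p (word [x])) = q (word [x])" for f g c x
      using that by (auto simp: natural_def algebra_hom_def ring_hom_def)
    have word: "\<eta> (p (word w)) = q (word w)" for w
    proof (induction w)
      case Nil
      then show ?case by (simp add: word_Nil A.p_one B.p_one \<eta>)
    next
      case (Cons x w)
      have "(word (x # w) :: _ \<Rightarrow>\<^sub>0 'k) = word [x] * word w" by (simp add: single_mult_single)
      then show ?case by (simp only: A.p_mult B.p_mult \<eta> Cons)
    qed
    show ?thesis
    proof (induction f rule: free_induct)
      case zero
      \<comment> \<open>The zero of \<open>B\<close> is only accessible as the scalar multiple \<open>0 \<odot> 1\<close>.\<close>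
      have "\<eta> (p (const 0 * 1)) = 0 \<odot>\<^bsub>B\<^esub> \<eta> (p 1)"
        by (subst A.p_const_mult) (rule \<eta>(4))
      also have "\<eta> (p 1) = q 1"
        by (subst A.p_one, subst B.p_one) (rule \<eta>(3))
      also have "0 \<odot>\<^bsub>B\<^esub> q 1 = q (const 0 * 1)"
        by (rule B.p_const_mult [symmetric])
      finally have "\<eta> (p (const 0 * 1)) = q (const 0 * 1)" .
      then show ?case by simp
    next
      case (add w c f)
      have "\<eta> (p (const c * word w)) = q (const c * word w)"
        by (simp only: A.p_const_mult B.p_const_mult \<eta> word)
      then have "\<eta> (p (const c * word w + f)) = q (const c * word w + f)"
        by (simp only: A.p_add B.p_add \<eta>(2) add.IH)
      then show ?case by (simp only: single_eq_const_word [symmetric])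
    qed
  qed
  have "\<eta> = \<xi>" if "natural \<eta>" for \<eta>
  proof (rule extensionalityI)
    show "\<eta> \<in> extensional (carrier A)" "\<xi> \<in> extensional (carrier A)"
      using that nat by (auto simp: natural_def)
    show "\<eta> a = \<xi> a" if "a \<in> carrier A" for a
      using determined [OF \<open>natural \<eta>\<close>] \<xi> A.carrier_cases [OF that] by metis
  qed
  moreover have "bij_betw \<xi> (carrier A) (carrier B)"
  proof (rule bij_betw_imageI)
    show "inj_on \<xi> (carrier A)"
      by (auto simp: inj_on_def \<xi> same dest!: A.carrier_cases)
    show "\<xi> ` carrier A = carrier B"
      by (simp add: A.range_p [symmetric] B.range_p [symmetric] image_image \<xi>)
  qed
  ultimately show ?thesis
    using nat hom unfolding algebra_iso_def by blast
qed

locale ring_presentation = algebra_presentation + ring A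
begin

lemma p_zero: "p 0 = \<zero>"
proof -
  have "p 0 \<oplus> p 0 = p 0" by (simp add: p_add [symmetric])
  then show ?thesis using add.r_cancel_one [of "p 0" "p 0"] by simp
qed

lemma p_uminus: "p (- f) = \<ominus> p f"
  by (rule minus_equality [symmetric]) (simp_all add: p_add [symmetric] p_zero)

lemma p_diff: "p (f - g) = p f \<ominus> p g"
  using p_add [of f "- g"] by (simp add: p_uminus a_minus_def)

lemma p_square: "p (f * f) = p f [^] (2::nat)"
  by (simp add: p_mult numeral_2_eq_2)

lemma mem_J_iff: "f \<in> J \<longleftrightarrow> p f = \<zero>"
  using p_eq_iff [of f 0] by (simp add: p_zero)

end

lemma quot_algebra_simps:
  "carrier (quot_algebra A I) = carrier (A Quot I)"
  "monoid.mult (quot_algebra A I) = monoid.mult (A Quot I)"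
  "one (quot_algebra A I) = one (A Quot I)"
  "zero (quot_algebra A I) = zero (A Quot I)"
  "add (quot_algebra A I) = add (A Quot I)"
  "smult (quot_algebra A I) c X = (\<Union>a\<in>X. I +>\<^bsub>A\<^esub> (c \<odot>\<^bsub>A\<^esub> a))"
  by (simp_all add: quot_algebra_def ring.defs module.defs)

text \<open>The identity is an isomorphism from the quotient ring to the same ring with scalars added.\<close>

lemma ring_quot_algebra:
  assumes "ideal I A"
  shows "ring (quot_algebra A I)"
proof -
  interpret Q: ring "A Quot I" by (rule ideal.quotient_is_ring) fact
  have "(\<lambda>X. X) \<in> ring_iso (A Quot I) (quot_algebra A I)"
    by (auto simp: ring_iso_def ring_hom_def quot_algebra_simps bij_betw_def)
  from Q.ring_iso_imp_img_ring [OF this] show ?thesis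
    by (simp add: quot_algebra_simps(4) [symmetric])
qed

lemma word_algebra_presentation: "ring_presentation word_algebra (\<lambda>f. f) {0}"
proof -
  have "abelian_group (word_algebra :: ('k::field, 'l list \<Rightarrow>\<^sub>0 'k) module)"
    by (rule abelian_groupI) (auto simp: word_algebra_def add.assoc add.commute intro: exI [of _ "- _"] ab_left_minus)
  moreover have "Group.monoid (word_algebra :: ('k::field, 'l list \<Rightarrow>\<^sub>0 'k) module)"
    by (rule monoidI) (auto simp: word_algebra_def mult.assoc)
  ultimately have "ring (word_algebra :: ('k::field, 'l list \<Rightarrow>\<^sub>0 'k) module)"
    by (rule ringI) (auto simp: word_algebra_def distrib_left distrib_right)
  then show ?thesis
    unfolding ring_presentation_def algebra_presentation_def
    by (simp add: word_algebra_def smult_eq_const_mult)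
qed

text \<open>Iterated quotients of the free algebra are again quotients of the free algebra: the preimage of the
ideal generated by \<open>p ` S'\<close> is the ideal generated by \<open>S \<union> S'\<close>.\<close>

lemma (in ring_presentation) quotient_presentation:
  assumes J: "J = two_sided S"
  shows "ring_presentation (quot_algebra A (Idl (p ` S'))) (\<lambda>f. Idl (p ` S') +> p f) (two_sided (S \<union> S'))"
proof -
  let ?K = "two_sided (S \<union> S')"
  define I where "I = Idl (p ` S')"
  have gens: "p ` S' \<subseteq> carrier A" by auto
  interpret I: ideal I A unfolding I_def by (rule genideal_ideal [OF gens])
  have "ideal (p ` ?K) A"
  proof (rule idealI)
    show "subgroup (p ` ?K) (add_monoid A)"
    proof (rule subgroup.intro)
      show "\<one>\<^bsub>add_monoid A\<^esub> \<in> p ` ?K" using p_zero by (force intro: image_eqI [of _ _ 0])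
      show "inv\<^bsub>add_monoid A\<^esub> x \<in> p ` ?K" if "x \<in> p ` ?K" for x
        using that by (force simp: a_inv_def [symmetric] p_uminus [symmetric] intro: two_sided_uminus)
    qed (auto simp: p_add [symmetric] intro: two_sided_add)
    show "x \<otimes> a \<in> p ` ?K" "a \<otimes> x \<in> p ` ?K" if "a \<in> p ` ?K" "x \<in> carrier A" for a x
      using that by (auto dest!: carrier_cases simp: p_mult [symmetric] intro: two_sided_mult_left two_sided_mult_right)
  qed (rule ring_axioms)
  moreover have "p ` S' \<subseteq> p ` ?K" by (auto intro: two_sided_base)
  ultimately have sub: "I \<subseteq> p ` ?K" unfolding I_def by (rule genideal_minimal)
  have JK: "J \<subseteq> ?K" unfolding J by (rule two_sided_mono) (auto intro: two_sided_base)
  have mem: "p f \<in> I \<longleftrightarrow> f \<in> ?K" for f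
  proof
    assume "p f \<in> I"
    then obtain g where "g \<in> ?K" "p f = p g" using sub by auto
    then have "f - g \<in> ?K" using JK p_eq_iff by auto
    from two_sided_add [OF this \<open>g \<in> ?K\<close>] show "f \<in> ?K" by simp
  next
    assume "f \<in> ?K"
    then have "f \<in> {f. p f \<in> I}"
    proof (rule two_sided_least)
      fix u c s v assume "s \<in> S \<union> S'"
      then have "p s \<in> I"
      proof
        assume "s \<in> S"
        then have "p s = \<zero>" using J two_sided_base mem_J_iff by blast
        then show ?thesis by simp
      next
        assume "s \<in> S'"
        then show ?thesis unfolding I_def using genideal_self [OF gens] by auto
      qed
      then show "Poly_Mapping.single u c * s * word v \<in> {f. p f \<in> I}"
        by (simp add: p_mult I.I_l_closed I.I_r_closed)
    qed (simp_all add: p_zero p_add)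
    then show "p f \<in> I" by simp
  qed
  have coset: "I +> p f = I +> p g \<longleftrightarrow> f - g \<in> ?K" for f g
    using quotient_eq_iff_same_a_r_cos [OF I.ideal_axioms, of "p f" "p g"] by (simp add: mem p_diff [symmetric])
  have scalar: "(\<Union>a\<in>I +> p f. I +> (c \<odot> a)) = I +> p (const c * f)" for c f
  proof -
    have "I +> (c \<odot> a) = I +> p (const c * f)" if a: "a \<in> I +> p f" for a
    proof -
      have "a \<in> carrier A" using a a_r_coset_subset_G [OF I.a_subset p_closed] by auto
      then obtain g where g: "a = p g" using carrier_cases by blast
      have "I +> p g = I +> p f" using a g a_repr_independence [OF _ _ I.a_subgroup] by auto
      then have "const c * (g - f) \<in> ?K" by (simp add: coset two_sided_mult_left)
      then show ?thesis by (simp add: g p_const_mult [symmetric] coset right_diff_distrib)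
    qed
    moreover have "p f \<in> I +> p f" by (simp add: I.a_rcos_self)
    ultimately show ?thesis by auto
  qed
  have "ring_presentation (quot_algebra A I) (\<lambda>f. I +> p f) ?K"
  proof (intro ring_presentation.intro algebra_presentation.intro)
    show "ring (quot_algebra A I)" by (rule ring_quot_algebra) (rule I.ideal_axioms)
    show "range (\<lambda>f. I +> p f) = carrier (quot_algebra A I)"
      unfolding quot_algebra_simps FactRing_simps by (auto dest!: carrier_cases intro!: bexI [of _ "p _"])
  qed (simp_all add: quot_algebra_simps FactRing_def I.rcoset_mult_add I.a_rcos_sum p_add p_mult p_one coset scalar)
  then show ?thesis unfolding I_def .
qed


section \<open>The associated graded algebra of a presented algebra\<close>

context ring_presentation
begin

text \<open>Mind the offset: \<open>words_below n\<close> is the part of degree \<open>< n\<close>, so that it maps onto \<open>F\<^bsub>n-1\<^esub>\<close>.\<close>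

definition fil :: "nat \<Rightarrow> 'a set" where "fil n = p ` words_below (Suc n)"

definition symbol :: "nat \<Rightarrow> ('c list \<Rightarrow>\<^sub>0 'b) \<Rightarrow> 'a set" where
  "symbol n f = fil_below A fil n +> p f"

lemma fil_below_fil: "fil_below A fil n = p ` words_below n"
  by (cases n) (simp_all add: fil_below_def fil_def p_zero)

lemma symbol_image: "symbol n f = (\<lambda>h. p (h + f)) ` words_below n"
  by (auto simp: symbol_def fil_below_fil a_r_coset_def r_coset_def p_add)

lemma symbol_eq_iff: "symbol n f = symbol n g \<longleftrightarrow> (\<exists>j\<in>J. f - g - j \<in> words_below n)"
proof
  assume "symbol n f = symbol n g"
  moreover have "p f \<in> symbol n f" unfolding symbol_image by (rule image_eqI [of _ _ 0]) simp_all
  ultimately obtain h where h: "h \<in> words_below n" "p f = p (h + g)" by (auto simp: symbol_image)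
  then have "f - g - h \<in> J" using p_eq_iff by (simp add: algebra_simps)
  then show "\<exists>j\<in>J. f - g - j \<in> words_below n"
    using h(1) by (intro bexI [of _ "f - g - h"]) simp_all
next
  have half: "symbol n f \<subseteq> symbol n g" if j: "j \<in> J" "f - g - j \<in> words_below n" for j f g
  proof
    fix a assume "a \<in> symbol n f"
    then obtain h where h: "h \<in> words_below n" "a = p (h + f)" by (auto simp: symbol_image)
    have "p (h + f) = p ((h + (f - g - j)) + g)"
      using j(1) by (simp add: p_eq_iff algebra_simps)
    with h(2) words_below_add [OF h(1) j(2)] show "a \<in> symbol n g"
      unfolding symbol_image by (metis (mono_tags) image_eqI)
  qed
  assume "\<exists>j\<in>J. f - g - j \<in> words_below n"
  then obtain j where j: "j \<in> J" "f - g - j \<in> words_below n" by auto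
  have "- j \<in> J" using j(1) by (simp add: mem_J_iff p_uminus)
  moreover have "g - f - - j \<in> words_below n" using words_below_uminus [OF j(2)] by (simp add: algebra_simps)
  ultimately show "symbol n f = symbol n g" using half j by blast
qed

lemma symbol_cong: "f - g \<in> words_below n \<Longrightarrow> symbol n f = symbol n g"
  using symbol_eq_iff [of n f g] by (metis diff_zero mem_J_iff p_zero)

lemma comm_group_fil: "comm_group \<lparr>carrier = fil n, monoid.mult = add A, one = \<zero>\<rparr>"
proof (rule comm_groupI)
  fix x assume "x \<in> carrier \<lparr>carrier = fil n, monoid.mult = add A, one = \<zero>\<rparr>"
  then obtain f where "f \<in> words_below (Suc n)" "x = p f" by (auto simp: fil_def)
  then show "\<exists>y\<in>carrier \<lparr>carrier = fil n, monoid.mult = add A, one = \<zero>\<rparr>.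
      y \<otimes>\<^bsub>\<lparr>carrier = fil n, monoid.mult = add A, one = \<zero>\<rparr>\<^esub> x = \<one>\<^bsub>\<lparr>carrier = fil n, monoid.mult = add A, one = \<zero>\<rparr>\<^esub>"
    by (auto simp: fil_def p_add [symmetric] p_zero intro!: bexI [of _ "- f"] words_below_uminus)
qed (auto simp: fil_def p_add [symmetric] p_zero [symmetric] words_below_add Groups.add_ac)

lemma subgroup_fil_below:
  "subgroup (fil_below A fil n) \<lparr>carrier = fil n, monoid.mult = add A, one = \<zero>\<rparr>"
proof -
  interpret F: comm_group "\<lparr>carrier = fil n, monoid.mult = add A, one = \<zero>\<rparr>" by (rule comm_group_fil)
  show ?thesis
  proof (rule F.subgroupI)
    fix x assume "x \<in> fil_below A fil n"
    then obtain f where f: "f \<in> words_below n" "x = p f" by (auto simp: fil_below_fil)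
    then have "f \<in> words_below (Suc n)" "- f \<in> words_below (Suc n)"
      by (auto intro: words_below_uminus words_below_mono)
    then have "inv\<^bsub>\<lparr>carrier = fil n, monoid.mult = add A, one = \<zero>\<rparr>\<^esub> x = p (- f)"
      using f by (intro F.inv_equality)
        (auto simp: fil_def p_add [symmetric] p_zero)
    then show "inv\<^bsub>\<lparr>carrier = fil n, monoid.mult = add A, one = \<zero>\<rparr>\<^esub> x \<in> fil_below A fil n"
      using f by (auto simp: fil_below_fil intro: words_below_uminus)
  next
    show "fil_below A fil n \<subseteq> carrier \<lparr>carrier = fil n, monoid.mult = add A, one = \<zero>\<rparr>"
      using words_below_mono [of _ n "Suc n"] by (auto simp: fil_below_fil fil_def)
    show "fil_below A fil n \<noteq> {}"
      using zero_in_words_below [of n] unfolding fil_below_fil by blast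
  qed (auto simp: fil_below_fil p_add [symmetric] words_below_add)
qed

lemma symbol_r_coset:
  "fil_below A fil n #>\<^bsub>\<lparr>carrier = fil n, monoid.mult = add A, one = \<zero>\<rparr>\<^esub> p f = symbol n f"
  by (simp add: symbol_def a_r_coset_def r_coset_def)

lemma comm_group_gr_piece: "comm_group (gr_piece A fil n)"
  unfolding gr_piece_def by (rule comm_group.abelian_FactGroup [OF comm_group_fil subgroup_fil_below])

lemma carrier_gr_piece: "carrier (gr_piece A fil n) = symbol n ` words_below (Suc n)"
proof -
  have "carrier (gr_piece A fil n)
      = (\<lambda>a. fil_below A fil n #>\<^bsub>\<lparr>carrier = fil n, monoid.mult = add A, one = \<zero>\<rparr>\<^esub> a) ` fil n"
    by (simp add: gr_piece_def carrier_FactGroup)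
  then show ?thesis
    by (simp only: fil_def [of n, THEN arg_cong [of _ _ "image _"]] image_image symbol_r_coset)
qed

lemma one_gr_piece: "\<one>\<^bsub>gr_piece A fil n\<^esub> = symbol n 0"
  by (simp add: gr_piece_def fil_below_fil symbol_image)

lemma mult_gr_piece:
  assumes "f \<in> words_below (Suc n)" "g \<in> words_below (Suc n)"
  shows "symbol n f \<otimes>\<^bsub>gr_piece A fil n\<^esub> symbol n g = symbol n (f + g)"
proof -
  interpret F: comm_group "\<lparr>carrier = fil n, monoid.mult = add A, one = \<zero>\<rparr>" by (rule comm_group_fil)
  interpret N: normal "fil_below A fil n" "\<lparr>carrier = fil n, monoid.mult = add A, one = \<zero>\<rparr>"
    using F.normal_iff_subgroup subgroup_fil_below by blast
  have "p f \<in> fil n" "p g \<in> fil n" using assms by (auto simp: fil_def)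
  with N.rcos_sum [of "p f" "p g"] show ?thesis
    by (simp add: gr_piece_def symbol_r_coset p_add [symmetric])
qed

lemma finprod_gr_piece:
  assumes "finite X" "\<And>i. i \<in> X \<Longrightarrow> h i \<in> words_below (Suc n)"
  shows "finprod (gr_piece A fil n) (\<lambda>i. symbol n (h i)) X = symbol n (sum h X)
    \<and> sum h X \<in> words_below (Suc n)"
  using assms
proof (induction X rule: finite_induct)
  case empty
  then show ?case using comm_group.axioms(1) [OF comm_group_gr_piece, of n]
    by (simp add: comm_monoid.finprod_empty one_gr_piece)
next
  case (insert i X)
  interpret P: comm_group "gr_piece A fil n" by (rule comm_group_gr_piece)
  from insert show ?case
    by (subst P.finprod_insert) (auto simp: carrier_gr_piece mult_gr_piece intro: words_below_add)
qed

lemma rcoset_mult_symbol: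
  assumes "f \<in> words_below (Suc i)" "g \<in> words_below (Suc j)"
  shows "rcoset_mult A (fil_below A fil (i + j)) (symbol i f) (symbol j g) = symbol (i + j) (f * g)"
proof -
  have "fil_below A fil (i + j) +> (p (h + f) \<otimes> p (h' + g)) = symbol (i + j) (f * g)"
    if "h \<in> words_below i" "h' \<in> words_below j" for h h'
  proof -
    have "(h + f) * (h' + g) - f * g = h * h' + h * g + f * h'" by (simp add: algebra_simps)
    moreover have "h * h' \<in> words_below (i + j)"
      using words_below_mult [OF that] by (rule words_below_mono) simp
    moreover have "h * g \<in> words_below (i + j)" "f * h' \<in> words_below (i + j)"
      using words_below_mult [OF that(1) assms(2)] words_below_mult [OF assms(1) that(2)] by simp_all
    ultimately have "symbol (i + j) ((h + f) * (h' + g)) = symbol (i + j) (f * g)"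
      by (intro symbol_cong) (simp add: words_below_add)
    then show ?thesis by (simp add: symbol_def p_mult)
  qed
  moreover have "0 \<in> words_below i" "0 \<in> words_below j" by simp_all
  ultimately show ?thesis unfolding rcoset_mult_def symbol_image [of i] symbol_image [of j] by blast
qed

lemma smult_symbol: "(\<Union>a\<in>symbol n f. fil_below A fil n +> (c \<odot> a)) = symbol n (const c * f)"
proof -
  have "fil_below A fil n +> (c \<odot> p (h + f)) = symbol n (const c * f)" if "h \<in> words_below n" for h
    using that symbol_cong [of "const c * (h + f)" "const c * f" n] words_below_const_mult [of h n c]
    by (simp add: symbol_def p_const_mult [symmetric] distrib_left)
  moreover have "0 \<in> words_below n" by simp
  ultimately show ?thesis unfolding symbol_image [of n f] by blast
qed

text \<open>The free algebra is graded, so it maps onto the graded algebra by taking the symbol of each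
homogeneous component.  The component of degree \<open>n\<close> dies precisely when it agrees with an element of
\<open>J\<close> up to terms of smaller length, that is, when it is a leading term of \<open>J\<close>.\<close>

lemma gr_presentation:
  "algebra_presentation (gr_algebra A fil) (\<lambda>f n. symbol n (component n f))
    {f. \<forall>n. \<exists>j\<in>J. component n f - j \<in> words_below n}"
proof (rule algebra_presentation.intro)
  let ?G = "\<lambda>f n. symbol n (component n f)"
  show "range ?G = carrier (gr_algebra A fil)"
  proof (intro equalityI subsetI)
    fix g assume "g \<in> range ?G"
    then obtain f where g: "g = ?G f" by auto
    obtain N where "f \<in> words_below N" using exists_words_below by blast
    then have "g n = \<one>\<^bsub>gr_piece A fil n\<^esub>" if "\<not> n < N" for n
      using that component_eq_0 [of f N n] by (simp add: g one_gr_piece)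
    then have "{n. g n \<noteq> \<one>\<^bsub>gr_piece A fil n\<^esub>} \<subseteq> {..<N}" by blast
    then have "finite {n. g n \<noteq> \<one>\<^bsub>gr_piece A fil n\<^esub>}" by (rule finite_subset) simp
    then show "g \<in> carrier (gr_algebra A fil)" by (simp add: gr_algebra_def g carrier_gr_piece)
  next
    fix g assume "g \<in> carrier (gr_algebra A fil)"
    then have g: "\<And>n. g n \<in> symbol n ` words_below (Suc n)" and fin: "finite {n. g n \<noteq> symbol n 0}"
      by (auto simp: gr_algebra_def carrier_gr_piece one_gr_piece)
    from g have "\<forall>n. \<exists>f. f \<in> words_below (Suc n) \<and> g n = symbol n f" by blast
    then obtain h where h: "\<And>n. h n \<in> words_below (Suc n)" "\<And>n. g n = symbol n (h n)" by metis
    define X where "X = {n. g n \<noteq> symbol n 0}"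
    have "?G (\<Sum>n\<in>X. component n (h n)) = g"
    proof
      fix n
      have "component n (\<Sum>n\<in>X. component n (h n)) = (\<Sum>m\<in>X. if m = n then component n (h n) else 0)"
        unfolding component_sum by (intro sum.cong) (auto simp: component_component)
      also have "\<dots> = (if n \<in> X then component n (h n) else 0)"
        using fin by (simp add: X_def sum.delta)
      finally have "?G (\<Sum>n\<in>X. component n (h n)) n = (if n \<in> X then symbol n (component n (h n)) else symbol n 0)"
        by simp
      \<comment> \<open>The representative chosen in degree \<open>n\<close> differs from its top component by lower terms.\<close>
      also have "\<dots> = g n"
        using symbol_cong [OF minus_component_words_below [OF h(1)], of n] h(2) [of n] by (simp add: X_def)
      finally show "?G (\<Sum>n\<in>X. component n (h n)) n = g n" .
    qed
    then show "g \<in> range ?G" by blast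
  qed
  show "?G (f + g) = ?G f \<oplus>\<^bsub>gr_algebra A fil\<^esub> ?G g" for f g
    by (simp add: gr_algebra_def mult_gr_piece component_add)
  show "?G (f * g) = ?G f \<otimes>\<^bsub>gr_algebra A fil\<^esub> ?G g" for f g
  proof
    fix n
    have eq: "rcoset_mult A (fil_below A fil n) (?G f i) (?G g (n - i))
        = symbol n (component i f * component (n - i) g)" if "i \<in> {..n}" for i
      using rcoset_mult_symbol [of "component i f" i "component (n - i) g" "n - i"] that by simp
    have below: "component i f * component (n - i) g \<in> words_below (Suc n)" if "i \<in> {..n}" for i
      using words_below_mult [of "component i f" "Suc i" "component (n - i) g" "Suc (n - i)"] that by simp
    interpret P: comm_group "gr_piece A fil n" by (rule comm_group_gr_piece)
    have "(?G f \<otimes>\<^bsub>gr_algebra A fil\<^esub> ?G g) n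
        = finprod (gr_piece A fil n) (\<lambda>i. symbol n (component i f * component (n - i) g)) {..n}"
      unfolding gr_algebra_def monoid.simps
      by (rule P.finprod_cong') (use eq below in \<open>auto simp: carrier_gr_piece\<close>)
    also have "\<dots> = symbol n (component n (f * g))"
      using finprod_gr_piece [OF _ below, of "{..n}"] by (simp add: component_mult)
    finally show "?G (f * g) n = (?G f \<otimes>\<^bsub>gr_algebra A fil\<^esub> ?G g) n" ..
  qed
  show "?G 1 = \<one>\<^bsub>gr_algebra A fil\<^esub>"
    by (rule ext) (simp add: gr_algebra_def one_gr_piece symbol_def p_one [symmetric]
        word_Nil [symmetric] component_single)
  show "?G (const c * f) = c \<odot>\<^bsub>gr_algebra A fil\<^esub> ?G f" for c f
    by (simp add: gr_algebra_def smult_symbol component_const_mult)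
  show "?G f = ?G g \<longleftrightarrow> f - g \<in> {f. \<forall>n. \<exists>j\<in>J. component n f - j \<in> words_below n}" for f g
    by (simp add: fun_eq_iff symbol_eq_iff component_diff)
qed

lemma gr_class_generator:
  "gr_class A fil 1 (p (word [x])) = (\<lambda>n. symbol n (component n (word [x])))"
  by (rule ext) (simp add: gr_class_def component_single one_gr_piece symbol_def)

end


section \<open>A linear diamond lemma\<close>

lemma free_induct_keys [consumes 1, case_names zero add]:
  fixes f :: "'l list \<Rightarrow>\<^sub>0 'k::field"
  assumes "Poly_Mapping.keys f \<subseteq> X" and "P 0"
    and step: "\<And>w c f. w \<in> X \<Longrightarrow> P f \<Longrightarrow> P (Poly_Mapping.single w c + f)"
  shows "P f"
  using assms(1)
proof (induction f rule: free_induct)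
  case zero
  then show ?case using assms(2) by simp
next
  case (add w c f)
  have "Poly_Mapping.keys (Poly_Mapping.single w c + f) = insert w (Poly_Mapping.keys f)"
    using add.hyps by (auto simp: in_keys_iff lookup_add lookup_single when_def split: if_splits)
  with add show ?case by (auto intro: step)
qed

lemma linext_cong:
  "(\<And>w. w \<in> Poly_Mapping.keys f \<Longrightarrow> \<phi> w = \<psi> w) \<Longrightarrow> linext \<phi> f = linext \<psi> f"
  by (simp add: linext_def)

text \<open>A rule \<open>(w, g)\<close> rewrites the word \<open>w\<close> to the linear combination \<open>g\<close> of smaller words.  The normal form
\<open>\<sigma>\<close> is defined by well-founded recursion, applying an arbitrarily chosen rule to each reducible word.
By induction it respects all rules for words smaller than \<open>w\<close>, hence it kills the difference of two
reducts of \<open>w\<close>, and so does not depend on the choice.\<close>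

lemma linear_confluence:
  fixes G :: "('l list \<times> ('l list \<Rightarrow>\<^sub>0 'k::field)) set" and r :: "('l list \<times> 'l list) set"
  assumes "wf r"
    and decreasing: "\<And>w g t. (w, g) \<in> G \<Longrightarrow> t \<in> Poly_Mapping.keys g \<Longrightarrow> (t, w) \<in> r"
    and confluent: "\<And>w g g'. (w, g) \<in> G \<Longrightarrow> (w, g') \<in> G \<Longrightarrow>
      g - g' \<in> additive_span {const c * (word w1 - g1) | c w1 g1. (w1, g1) \<in> G \<and> (w1, w) \<in> r}"
  shows "\<exists>\<sigma>. (\<forall>(w, g) \<in> G. linext \<sigma> g = \<sigma> w) \<and> (\<forall>w. (\<nexists>g. (w, g) \<in> G) \<longrightarrow> \<sigma> w = word w)"
proof -
  define F where "F s w = (if \<exists>g. (w, g) \<in> G then linext s (SOME g. (w, g) \<in> G) else word w)"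
    for s :: "'l list \<Rightarrow> ('l list \<Rightarrow>\<^sub>0 'k)" and w
  define \<sigma> where "\<sigma> = wfrec r F"
  have rec: "\<sigma> w = F \<sigma> w" for w
  proof -
    have "\<sigma> w = F (cut \<sigma> r w) w"
      unfolding \<sigma>_def by (rule wfrec [OF \<open>wf r\<close>])
    also have "\<dots> = F \<sigma> w"
    proof (cases "\<exists>g. (w, g) \<in> G")
      case True
      then have "(w, SOME g. (w, g) \<in> G) \<in> G" by (rule someI_ex)
      with True show ?thesis
        unfolding F_def by (auto intro!: linext_cong simp: cut_apply decreasing)
    qed (simp add: F_def)
    finally show ?thesis .
  qed
  have "\<forall>g. (w, g) \<in> G \<longrightarrow> linext \<sigma> g = \<sigma> w" for w
    using \<open>wf r\<close>
  proof (induction w rule: wf_induct_rule)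
    case (less w)
    show ?case
    proof (intro allI impI)
      fix g assume g: "(w, g) \<in> G"
      define g' where "g' = (SOME g. (w, g) \<in> G)"
      have g': "(w, g') \<in> G" unfolding g'_def using g by (rule someI)
      have "linext \<sigma> f = 0"
        if "f \<in> additive_span {const c * (word w1 - g1) | c w1 g1. (w1, g1) \<in> G \<and> (w1, w) \<in> r}" for f
        using that
      proof induction
        case (add s f)
        then obtain c w1 g1 where s: "s = const c * (word w1 - g1)" and "(w1, g1) \<in> G" "(w1, w) \<in> r"
          by auto
        then have "linext \<sigma> g1 = \<sigma> w1" using less by blast
        then show ?case using add by (simp add: s linext_add linext_const_mult linext_diff)
      qed simp
      from this [OF confluent [OF g g']] have "linext \<sigma> g = linext \<sigma> g'"
        by (simp add: linext_diff)
      also have "\<dots> = \<sigma> w" unfolding rec [of w] F_def g'_def using g by auto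
      finally show "linext \<sigma> g = \<sigma> w" .
    qed
  qed
  moreover have "\<sigma> w = word w" if "\<nexists>g. (w, g) \<in> G" for w
    using rec [of w] that by (simp add: F_def)
  ultimately show ?thesis by (intro exI [of _ \<sigma>]) auto
qed


section \<open>Consequences of the axioms\<close>

context restricted_lie_superalgebra_ver4p
begin

lemma two_eq_0: "(1::'a) + 1 = 0"
  using char_2 of_nat_CHAR [where 'a='a] by simp

lemma char2 [simp]: "x + x = (0::'b)"
  using scale_left_distrib [of 1 1 x] by (simp add: two_eq_0 del: one_add_one)

lemma char2_word [simp]: "f + f = 0"
  for f :: "'c list \<Rightarrow>\<^sub>0 'a"
  by (rule poly_mapping_eqI) (metis lookup_add lookup_zero mult_2 mult_zero_left one_add_one two_eq_0)

lemma char2_cancel [simp]: "x + (x + y) = (y::'b)"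
  by (simp add: add.assoc [symmetric])

lemma char2_word_cancel [simp]: "f + (f + g) = g"
  for f :: "'c list \<Rightarrow>\<^sub>0 'a"
  by (simp add: add.assoc [symmetric])

lemma uminus_eq [simp]: "- x = (x::'b)"
  using char2 minus_unique by blast

lemma uminus_word_eq [simp]: "- f = f"
  for f :: "'c list \<Rightarrow>\<^sub>0 'a"
  using char2_word minus_unique by blast

lemma diff_word_eq_add: "f - g = f + g"
  for f :: "'c list \<Rightarrow>\<^sub>0 'a"
  by (simp add: diff_conv_add_uminus del: add_uminus_conv_diff)

lemma eq_iff_add_eq_0: "f = g \<longleftrightarrow> f + g = 0"
  for f :: "'c list \<Rightarrow>\<^sub>0 'a"
  by (metis add_eq_0_iff uminus_word_eq)

lemma word_add_eq_iff: "f + g = h \<longleftrightarrow> f = h + g"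
  for f :: "'c list \<Rightarrow>\<^sub>0 'a"
  by (auto simp: add.assoc)

lemma D_linear: "D (x + y) = D x + D y" "D (scale c x) = scale c (D x)" "D 0 = 0"
  using linear_D by (simp_all add: Vector_Spaces.linear.axioms module_hom.add module_hom.scale module_hom.zero
      Vector_Spaces.linear_iff_module_hom)

lemma br_linear:
  "br (x + x') y = br x y + br x' y" "br (scale c x) y = scale c (br x y)" "br 0 y = 0"
  "br x (y + y') = br x y + br x y'" "br x (scale c y) = scale c (br x y)" "br x 0 = 0"
  using linear_br_left [of y] linear_br_right [of x]
  by (auto simp: Vector_Spaces.linear_iff_module_hom dest: module_hom.add module_hom.scale module_hom.zero)

lemma br_commute_Ker: "D x = 0 \<Longrightarrow> br y x = br x y"
  using br_commute [of x y] by (simp add: br_linear)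

lemma Q_Ker_add: "D x = 0 \<Longrightarrow> D y = 0 \<Longrightarrow> Q (x + y) = Q x + Q y + br x y"
  using Q_polar [of x y] by (simp add: Ker_D_def algebra_simps)

lemma Q_scale: "D x = 0 \<Longrightarrow> Q (scale c x) = scale (c\<^sup>2) (Q x)"
  using quadratic_Q_Ker_D by (simp add: quadratic_on_def Ker_D_def)

lemma D_Q: "D x = 0 \<Longrightarrow> D (Q x) = 0"
  using Q_Ker_D by (simp add: Ker_D_def)

lemma Q_zero [simp]: "Q 0 = 0"
  using Q_Ker_add [of 0 0] D_linear(3) by (simp add: br_linear)

text \<open>On \<open>Ker D\<close> the adjoint action satisfies the ordinary Jacobi identity, since the braiding corrections
vanish.\<close>

lemma br_br_Ker:
  assumes "D x = 0" "D y = 0"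
  shows "br (br x y) z = br x (br y z) + br y (br x z)"
proof -
  have "D (br x z) = br x (D z)" "D (br y x) = 0" "D (br y z) = br y (D z)"
    using assms by (simp_all add: D_br br_linear)
  have "br (br z x) y = br y (br x z)" "br (br y z) x = br x (br y z)"
    using assms br_commute_Ker by metis+
  then have "br (br x y) z + (br x (br y z) + br y (br x z)) = 0"
    using jacobi [of x y z] assms by (simp add: br_linear add_ac)
  then show ?thesis by (metis add_eq_0_iff uminus_eq)
qed

text \<open>The formula is assumed on \<open>L0\<close> and on \<open>L1\<close>; the cross term \<open>[a,b]\<close> of \<open>Q(a + b)\<close> contributes exactly
the mixed terms of \<open>[a + b,[a + b,z]]\<close>.\<close>

lemma br_Q_Ker:
  assumes "D x = 0"
  shows "br (Q x) z = br x (br x z)"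
proof -
  from assms L0_plus_L1 obtain a b where x: "x = a + b" and a: "a \<in> L0" and b: "b \<in> L1"
    by (simp add: set_eq_iff Ker_D_def) metis
  then have D: "D a = 0" "D b = 0" using L0_bounds L1_bounds by (auto simp: Ker_D_def)
  then have "br (Q x) z = br (Q a) z + br (Q b) z + br (br a b) z"
    by (simp add: x Q_Ker_add br_linear)
  then show ?thesis
    by (simp add: br_Q_L0 [OF a] br_Q_L1 [OF b] br_br_Ker [OF D] x br_linear add_ac)
qed

text \<open>The Jacobi identity in the form in which it arises when a descending product \<open>xyz\<close> is sorted, so with
\<open>[x,z]\<close> in place of \<open>[z,x]\<close>.  The two differ by the Jacobi identity for \<open>x'\<close>, \<open>y\<close>, \<open>z'\<close>.\<close>

lemma jacobi_sorted:
  "br (br x y) z + br (br x z) y + br (br y z) x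
    + br (br (D z) x) (D y) + br (br (D y) z) (D x) + br (br (D z) y) (D x) = 0"
proof -
  have "br (br z x) y = br (br x z) y + br (br (D x) (D z)) y"
    using br_commute [of z x] by (simp add: br_linear)
  moreover have "br (br (D x) y) (D z) + br (br (D z) (D x)) y + br (br y (D z)) (D x) = 0"
    using jacobi [of "D x" y "D z"] by (simp add: D_D br_linear)
  moreover have "br (D z) (D x) = br (D x) (D z)" "br y (D z) = br (D z) y"
    using br_commute_Ker D_D by blast+
  ultimately have
    "br (br x y) z + (br (br x z) y + br (br (D x) (D z)) y) + br (br y z) x
       + br (br (D x) y) (D z) + br (br (D z) x) (D y) + br (br (D y) z) (D x)
     + (br (br (D x) y) (D z) + br (br (D x) (D z)) y + br (br (D z) y) (D x)) = 0"
    using jacobi [of x y z] by simp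
  then show ?thesis by (simp add: add_ac)
qed


text \<open>Applying \<open>D\<close> to a linear relation kills the part in \<open>C\<close> and leaves a relation among the elements of
\<open>D ` E\<close>.\<close>

lemma independent_Ker_Un_lifts:
  assumes "independent C" "C \<subseteq> Ker_D" "inj_on D E" "independent (D ` E)"
  shows "independent (C \<union> E)"
  unfolding independent_explicit_module
proof (intro allI impI)
  fix T u v assume T: "finite T" "T \<subseteq> C \<union> E" "(\<Sum>w\<in>T. scale (u w) w) = 0" and v: "v \<in> T"
  interpret D: module_hom scale scale D
    using linear_D by (simp add: Vector_Spaces.linear_iff_module_hom)
  have "0 = (\<Sum>w\<in>T. scale (u w) (D w))"
    using arg_cong [OF T(3), of D] by (simp add: D.sum D.scale)
  also have "\<dots> = (\<Sum>w\<in>T - C. scale (u w) (D w))"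
    using T(1) assms(2) by (intro sum.mono_neutral_right) (auto simp: Ker_D_def)
  also have "\<dots> = (\<Sum>e\<in>D ` (T - C). scale (u (inv_into E D e)) e)"
    using T(2) assms(3) by (subst sum.reindex) (auto intro: inj_on_subset intro!: sum.cong)
  finally have "u (inv_into E D e) = 0" if "e \<in> D ` (T - C)" for e
    using that T by (intro independentD [OF assms(4), of "D ` (T - C)"]) auto
  then have E: "u w = 0" if "w \<in> T - C" for w
    using that T(2) assms(3) by force
  have "0 = (\<Sum>w\<in>T \<inter> C. scale (u w) w)"
    unfolding T(3) [symmetric] using T(1) E by (intro sum.mono_neutral_right) auto
  then have "u w = 0" if "w \<in> T \<inter> C" for w
    using that T(1) by (intro independentD [OF assms(1), of "T \<inter> C"]) auto
  then show "u v = 0" using E v by blast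
qed

text \<open>Extend a basis \<open>I\<close> of \<open>Im D\<close> to a basis \<open>C\<close> of \<open>Ker D\<close>, and add one preimage under \<open>D\<close> of each element
of \<open>I\<close>.\<close>

lemma exists_adapted_basis:
  "\<exists>B. independent B \<and> span B = UNIV \<and> Ker_D \<subseteq> span {b \<in> B. D b = 0} \<and>
    (\<forall>b\<in>B. D b = 0 \<or> D b \<in> B)"
proof -
  interpret D: module_hom scale scale D
    using linear_D by (simp add: Vector_Spaces.linear_iff_module_hom)
  obtain I where I: "I \<subseteq> range D" "independent I" "range D \<subseteq> span I"
    using basis_exists [of "range D"] by metis
  have "I \<subseteq> Ker_D" using I(1) D_D by (auto simp: Ker_D_def)
  then obtain C where C: "I \<subseteq> C" "C \<subseteq> Ker_D" "independent C" "Ker_D \<subseteq> span C"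
    using maximal_independent_subset_extend [OF _ I(2)] by metis
  define E where "E = inv_into UNIV D ` I"
  have DE: "D (inv_into UNIV D i) = i" if "i \<in> I" for i
    using that I(1) by (auto intro: f_inv_into_f)
  have inj: "inj_on D E" and image: "D ` E = I"
    by (auto simp: E_def inj_on_def DE image_image)
  have "independent (C \<union> E)"
    using independent_Ker_Un_lifts [OF C(3) C(2) inj] image I(2) by simp
  moreover have "x \<in> span (C \<union> E)" for x
  proof -
    have "D x \<in> span (D ` E)" using I(3) image by auto
    then obtain e where e: "e \<in> span E" "D x = D e"
      by (auto simp: D.span_image)
    then have "x - e \<in> span C" using C(4) by (auto simp: Ker_D_def D.diff)
    then have "x - e \<in> span (C \<union> E)" "e \<in> span (C \<union> E)"
      using e(1) span_mono [of C "C \<union> E"] span_mono [of E "C \<union> E"] by blast+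
    then show ?thesis using span_add by fastforce
  qed
  moreover have "C = {b \<in> C \<union> E. D b = 0}"
    using C(2) I(2) image dependent_zero [of I] by (force simp: Ker_D_def)
  moreover have "\<forall>b\<in>C \<union> E. D b = 0 \<or> D b \<in> C \<union> E"
    using C(1,2) image by (force simp: Ker_D_def)
  ultimately show ?thesis using C(4) by (intro exI [of _ "C \<union> E"]) auto
qed

end


section \<open>The straightening relations\<close>

locale adapted_basis = restricted_lie_superalgebra_ver4p scale D br L0 L1 Q
  for scale :: "'k::field \<Rightarrow> 'l::ab_group_add \<Rightarrow> 'l" (infixr \<open>*s\<close> 75)
    and D br L0 L1 Q +
  fixes B :: "'l set" and lt :: "'l \<Rightarrow> 'l \<Rightarrow> bool"  (infix \<open>\<prec>\<close> 50)
  assumes independent_B: "independent B" and span_B: "span B = UNIV"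
    and Ker_D_span: "Ker_D \<subseteq> span {b \<in> B. D b = 0}"
    and D_B: "b \<in> B \<Longrightarrow> D b = 0 \<or> D b \<in> B"
    and lt_irrefl: "\<not> b \<prec> b"
    and lt_trans: "b \<prec> c \<Longrightarrow> c \<prec> d \<Longrightarrow> b \<prec> d"
    and lt_total: "b \<noteq> c \<Longrightarrow> b \<prec> c \<or> c \<prec> b"
begin

text \<open>The expansion of a vector in the basis \<open>B\<close>, as a combination of one-letter words.\<close>

definition emb :: "'l \<Rightarrow> ('l list \<Rightarrow>\<^sub>0 'k)" where
  "emb x = (\<Sum>b | representation B x b \<noteq> 0. Poly_Mapping.single [b] (representation B x b))"

lemma lookup_emb: "Poly_Mapping.lookup (emb x) w = (case w of [b] \<Rightarrow> representation B x b | _ \<Rightarrow> 0)"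
proof -
  have "Poly_Mapping.lookup (emb x) w
      = (\<Sum>b | representation B x b \<noteq> 0. if w = [b] then representation B x b else 0)"
    unfolding emb_def lookup_sum by (intro sum.cong) (auto simp: lookup_single when_def)
  also have "\<dots> = (case w of [b] \<Rightarrow> representation B x b | _ \<Rightarrow> 0)"
    using finite_representation [of B x] by (auto split: list.split simp: sum.delta)
  finally show ?thesis .
qed

lemma emb_add: "emb (x + y) = emb x + emb y"
  by (rule poly_mapping_eqI)
    (simp add: lookup_emb lookup_add representation_add [OF independent_B] span_B split: list.split)

lemma emb_scale: "emb (scale c x) = const c * emb x"
  by (rule poly_mapping_eqI)
    (simp add: lookup_emb lookup_const_mult representation_scale [OF independent_B] span_B split: list.split)

lemma emb_zero [simp]: "emb 0 = 0"
  using emb_scale [of 0 0] by simp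

lemma emb_basis: "b \<in> B \<Longrightarrow> emb b = word [b]"
  by (rule poly_mapping_eqI)
    (auto simp: lookup_emb lookup_single when_def representation_basis [OF independent_B] split: list.split)

lemma keys_emb: "w \<in> Poly_Mapping.keys (emb x) \<Longrightarrow> \<exists>b\<in>B. w = [b]"
  using representation_ne_zero [of B x]
  by (auto simp: in_keys_iff lookup_emb split: list.splits)

text \<open>Since \<open>-1 = 1\<close>, \<open>R x y\<close> and \<open>q x\<close> are the expansions in the basis of the defining relations
\<open>xy - yx - y'x' - [x,y]\<close> and \<open>x\<^sup>2 - Q(x)\<close> of the restricted enveloping algebra.\<close>

definition R :: "'l \<Rightarrow> 'l \<Rightarrow> ('l list \<Rightarrow>\<^sub>0 'k)" where
  "R x y = emb x * emb y + emb y * emb x + emb (D y) * emb (D x) + emb (br x y)"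

definition q :: "'l \<Rightarrow> ('l list \<Rightarrow>\<^sub>0 'k)" where
  "q x = emb x * emb x + emb (Q x)"

lemma R_linear:
  "R (x + x') y = R x y + R x' y" "R (scale c x) y = const c * R x y" "R 0 y = 0"
  "R x (y + y') = R x y + R x y'" "R x (scale c y) = const c * R x y" "R x 0 = 0"
  by (simp_all add: R_def emb_add emb_scale D_linear br_linear distrib_left distrib_right add_ac
      mult.assoc const_left_commute [of "emb _"])

text \<open>So the relation for \<open>(y, x)\<close> follows from the one for \<open>(x, y)\<close> and a relation inside \<open>Ker D\<close>.\<close>

lemma R_swap: "R x y + R y x = R (D y) (D x)"
  using emb_add [of "br x y" "br y x"] br_commute [of x y]
  by (simp add: R_def D_D add_ac)

text \<open>This is where \<open>Q(x') = [x,x]\<close> is used: the relation for a repeated letter outside \<open>Ker D\<close> is a square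
relation in \<open>Im D\<close>.\<close>

lemma R_self: "R x x = q (D x)"
  by (simp add: R_def q_def Q_D)

lemma q_zero: "q 0 = 0"
  by (simp add: q_def)

lemma q_add: "D x = 0 \<Longrightarrow> D y = 0 \<Longrightarrow> q (x + y) = q x + q y + R x y"
  by (simp add: q_def R_def emb_add Q_Ker_add distrib_left distrib_right add_ac)

lemma q_scale: "D x = 0 \<Longrightarrow> q (scale c x) = const (c\<^sup>2) * q x"
  by (simp add: q_def Q_scale emb_scale distrib_left mult.assoc const_left_commute [of "emb x"]
      const_mult_const power2_eq_square)

text \<open>The hexagon of the six ways to order \<open>x\<close>, \<open>y\<close>, \<open>z\<close>, each edge being a relation \<open>R\<close> with a third letter on
one side.  The cubic terms cancel up to the terms with two letters replaced by their derivatives; these are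
commutators and produce the second group.  The quadratic terms are commutators with brackets and produce
the third group, and the linear terms that remain add up to the Jacobi identity.\<close>

lemma R_overlap:
  "R x y * emb z + emb x * R y z =
      emb y * R x z + R y z * emb x + R x z * emb y + emb z * R x y
    + (emb (D y) * R (D x) z + R (D y) z * emb (D x) + emb (D z) * R (D x) y + R (D z) y * emb (D x)
      + emb (D z) * R (D y) x + R (D z) x * emb (D y))
    + (R (br x y) z + R (br x z) y + R (br y z) x
      + R (br (D z) x) (D y) + R (br (D y) z) (D x) + R (br (D z) y) (D x))"
proof -
  have comm: "br x (D y) = br (D y) x" "br x (D z) = br (D z) x" "br y (D z) = br (D z) y"
    using br_commute_Ker D_D by blast+
  have "emb (br (br x y) z + br (br x z) y + br (br y z) x
      + br (br (D z) x) (D y) + br (br (D y) z) (D x) + br (br (D z) y) (D x)) = 0"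
    by (simp only: jacobi_sorted emb_zero)
  then have J: "emb (br (br x y) z) + (emb (br (br x z) y) + (emb (br (br y z) x)
      + (emb (br (br (D z) x) (D y)) + (emb (br (br (D y) z) (D x)) + emb (br (br (D z) y) (D x)))))) = 0"
    by (simp only: emb_add add.assoc)
  show ?thesis
    unfolding eq_iff_add_eq_0 [of "R x y * emb z + emb x * R y z"]
    by (subst J [symmetric], unfold R_def D_br comm D_D emb_add)
      (simp add: distrib_left distrib_right mult.assoc add_ac)
qed

text \<open>All terms cancel except the difference between \<open>[Q(x),z]\<close> and \<open>[x,[x,z]]\<close>.\<close>

lemma q_overlap:
  assumes "D x = 0"
  shows "q x * emb z + emb x * R x z = R x z * emb x + emb z * q x + R (Q x) z + R x (br x z)"
  unfolding eq_iff_add_eq_0 [of "q x * emb z + emb x * R x z"]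
  by (simp add: q_def R_def assms D_Q br_Q_Ker distrib_left distrib_right mult.assoc add_ac)

subsection \<open>Reductions and the order on words\<close>

text \<open>A reducible pair of adjacent letters: a descent, or a repeated letter of \<open>Ker D\<close>.  Its leading word
\<open>xy\<close> is to be replaced by \<open>tail x y\<close>.\<close>

definition red :: "'l \<Rightarrow> 'l \<Rightarrow> bool" where
  "red x y \<longleftrightarrow> x \<in> B \<and> y \<in> B \<and> (y \<prec> x \<or> x = y \<and> D x = 0)"

definition rel :: "'l \<Rightarrow> 'l \<Rightarrow> ('l list \<Rightarrow>\<^sub>0 'k)" where
  "rel x y = (if x = y then q x else R x y)"

definition tail :: "'l \<Rightarrow> 'l \<Rightarrow> ('l list \<Rightarrow>\<^sub>0 'k)" where
  "tail x y = rel x y + word [x, y]"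

text \<open>\<open>wt w\<close> counts the letters of \<open>w\<close> outside \<open>Ker D\<close>.\<close>

definition ht :: "'l \<Rightarrow> nat" where "ht x = (if D x = 0 then 0 else 1)"

definition wt :: "'l list \<Rightarrow> nat" where "wt w = sum_list (map ht w)"

definition below_count :: "'l \<Rightarrow> 'l list \<Rightarrow> nat" where
  "below_count x w = length (filter (\<lambda>y. y \<prec> x) w)"

fun inversions :: "'l list \<Rightarrow> nat" where
  "inversions [] = 0"
| "inversions (x # w) = below_count x w + inversions w"

definition word_order :: "('l list \<times> 'l list) set" where
  "word_order = inv_image (less_than <*lex*> less_than <*lex*> less_than) (\<lambda>w. (length w, wt w, inversions w))"

lemma wf_word_order: "wf word_order"
  unfolding word_order_def by (intro wf_inv_image wf_lex_prod wf_less_than)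

lemma word_order_iff: "(u, v) \<in> word_order \<longleftrightarrow> length u < length v \<or> length u = length v \<and>
    (wt u < wt v \<or> wt u = wt v \<and> inversions u < inversions v)"
  by (auto simp: word_order_def)

lemma wt_simps [simp]: "wt [] = 0" "wt (x # w) = ht x + wt w" "wt (u @ v) = wt u + wt v"
  by (simp_all add: wt_def)

lemma inversions_append:
  "inversions (u @ v) = inversions u + inversions v + sum_list (map (\<lambda>x. below_count x v) u)"
  by (induction u) (simp_all add: below_count_def)

lemma below_count_mset: "mset u = mset v \<Longrightarrow> below_count x u = below_count x v"
  unfolding below_count_def by (metis mset_filter size_mset)

text \<open>Rearranging a subword does not change its inversions with the letters around it.  (The order is not
compatible with concatenation in general, as exchanging letters for others may create inversions.)\<close>

lemma word_order_perm:
  assumes "mset s = mset t" "inversions s < inversions t"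
  shows "(u @ s @ v, u @ t @ v) \<in> word_order"
proof -
  have "sum_list (map f s) = sum_list (map f t)" for f :: "'l \<Rightarrow> nat"
    using assms(1) by (metis mset_map sum_mset_sum_list)
  moreover have "length s = length t" using assms(1) by (rule mset_eq_length)
  moreover have "below_count x (s @ v) = below_count x (t @ v)" for x
    using assms(1) by (intro below_count_mset) simp
  ultimately show ?thesis
    using assms(2) by (simp add: word_order_iff inversions_append wt_def)
qed

text \<open>\<open>yx\<close> has one inversion less than \<open>xy\<close>, \<open>y'x'\<close> has two letters of \<open>B - Ker D\<close> less, and the bracket and \<open>Q\<close>
are shorter.  All three comparisons persist in a context.\<close>

lemma tail_keys:
  assumes "red x y" "t \<in> Poly_Mapping.keys (tail x y)"
  shows "set t \<subseteq> B" and "(u @ t @ v, u @ [x, y] @ v) \<in> word_order"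
proof -
  have B: "x \<in> B" "y \<in> B" using assms(1) by (auto simp: red_def)
  have single: "set t \<subseteq> B \<and> (u @ t @ v, u @ [x, y] @ v) \<in> word_order"
    if "t \<in> Poly_Mapping.keys (emb a)" for a
    using keys_emb [OF that] by (auto simp: word_order_iff)
  have "set t \<subseteq> B \<and> (u @ t @ v, u @ [x, y] @ v) \<in> word_order"
  proof (cases "x = y")
    case True
    then have "tail x y = emb (Q x)"
      using B by (simp add: tail_def rel_def q_def emb_basis single_mult_single add_ac)
    then show ?thesis using single assms(2) by simp
  next
    case False
    then have "y \<prec> x" using assms(1) by (simp add: red_def)
    have "tail x y = word [y, x] + emb (D y) * emb (D x) + emb (br x y)"
      using B False by (simp add: tail_def rel_def R_def emb_basis single_mult_single add_ac)
    then consider "t = [y, x]" | "t \<in> Poly_Mapping.keys (emb (D y) * emb (D x))"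
      | "t \<in> Poly_Mapping.keys (emb (br x y))"
      using assms(2) by (fastforce simp: in_keys_iff lookup_add lookup_single when_def split: if_splits)
    then show ?thesis
    proof cases
      case 1
      have "inversions [y, x] < inversions [x, y]"
        using \<open>y \<prec> x\<close> lt_trans [of x y x] lt_irrefl by (auto simp: below_count_def)
      then show ?thesis using B word_order_perm [of "[y, x]" "[x, y]"] 1 by auto
    next
      case 2
      then have "D x \<noteq> 0" "D y \<noteq> 0" by auto
      moreover from this have "D x \<in> B" "D y \<in> B" using B D_B by blast+
      moreover from this have "t = [D y, D x]"
        using 2 by (simp add: emb_basis single_mult_single)
      ultimately show ?thesis
        by (simp add: word_order_iff ht_def D_D)
    next
      case 3
      then show ?thesis by (rule single)
    qed
  qed
  then show "set t \<subseteq> B" "(u @ t @ v, u @ [x, y] @ v) \<in> word_order" by blast+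
qed


subsection \<open>Spans of relations\<close>

text \<open>The span of the relations \<open>u (xy - tail) v\<close> whose leading word satisfies \<open>P\<close>.\<close>

definition rel_span :: "('l list \<Rightarrow> bool) \<Rightarrow> ('l list \<Rightarrow>\<^sub>0 'k) set" where
  "rel_span P = additive_span {Poly_Mapping.single u c * rel x y * word v | u c x y v.
     red x y \<and> set u \<subseteq> B \<and> set v \<subseteq> B \<and> P (u @ [x, y] @ v)}"

lemma rel_span_zero: "0 \<in> rel_span P"
  and rel_span_add: "f \<in> rel_span P \<Longrightarrow> g \<in> rel_span P \<Longrightarrow> f + g \<in> rel_span P"
  by (simp_all add: rel_span_def additive_span.zero additive_span_plus)

lemma rel_span_base:
  "red x y \<Longrightarrow> set u \<subseteq> B \<Longrightarrow> set v \<subseteq> B \<Longrightarrow> P (u @ [x, y] @ v)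
    \<Longrightarrow> Poly_Mapping.single u c * rel x y * word v \<in> rel_span P"
  unfolding rel_span_def by (rule additive_span_base) blast

lemma rel_span_sandwich:
  assumes "f \<in> rel_span P" and u: "set u \<subseteq> B" and v: "set v \<subseteq> B" and "\<And>w. P w \<Longrightarrow> P' (u @ w @ v)"
  shows "Poly_Mapping.single u c * f * word v \<in> rel_span P'"
  using assms(1) unfolding rel_span_def [of P]
proof induction
  case zero
  then show ?case by (simp add: rel_span_zero)
next
  case (add s f)
  then obtain u' c' x y v' where s: "s = Poly_Mapping.single u' c' * rel x y * word v'"
    and "red x y" "set u' \<subseteq> B" "set v' \<subseteq> B" "P (u' @ [x, y] @ v')" by auto
  moreover have "Poly_Mapping.single u c * s * word v = Poly_Mapping.single (u @ u') (c * c') * rel x y * word (v' @ v)"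
  proof -
    have "Poly_Mapping.single u c * s * word v
        = (Poly_Mapping.single u c * Poly_Mapping.single u' c') * rel x y * (word v' * word v)"
      by (simp only: s mult.assoc)
    then show ?thesis by (simp only: single_mult_single mult_1_right)
  qed
  ultimately have "Poly_Mapping.single u c * s * word v \<in> rel_span P'"
    using u v assms(4) [of "u' @ [x, y] @ v'"] by (auto intro!: rel_span_base)
  then show ?case using add by (simp add: distrib_left distrib_right rel_span_add)
qed

lemma rel_span_const_mult: "f \<in> rel_span P \<Longrightarrow> const c * f \<in> rel_span P"
  using rel_span_sandwich [of f P "[]" "[]" P c] by (simp add: word_Nil)

text \<open>A subspace that contains the relations of the reducible basis pairs contains the relations of all
vectors, by bilinearity of \<open>R\<close> and by polarization for \<open>q\<close>.  The remaining basis pairs reduce to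
reducible ones by \<open>R_swap\<close> and \<open>R_self\<close>, at the cost of relations inside \<open>Ker D\<close>; this is why the claim
can be graded by the number \<open>h\<close> of letters outside \<open>Ker D\<close>.\<close>

lemma R_q_mem:
  assumes zero: "0 \<in> T" and add: "\<And>f g. f \<in> T \<Longrightarrow> g \<in> T \<Longrightarrow> f + g \<in> T"
    and scale: "\<And>c f. f \<in> T \<Longrightarrow> const c * f \<in> T"
    and red: "\<And>b c. red b c \<Longrightarrow> ht b + ht c \<le> h \<Longrightarrow> rel b c \<in> T"
  shows "ht x + ht y \<le> h \<Longrightarrow> R x y \<in> T" and "D x = 0 \<Longrightarrow> q x \<in> T"
proof -
  have q_basis: "q b \<in> T" if "b \<in> B" "D b = 0" for b
    using red [of b b] that by (simp add: red_def rel_def ht_def)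
  have swap: "R b c = R c b + R (D c) (D b)" for b c
    using R_swap [of b c] by (simp add: word_add_eq_iff [of "R b c"] add.commute)
  have q_D: "q (D b) \<in> T" if "b \<in> B" for b
    using D_B [OF that] q_basis [of "D b"] zero by (auto simp: q_zero D_D)
  have sorted: "R b c \<in> T" if "b \<in> B" "c \<in> B" "ht b + ht c \<le> h" "\<not> b \<prec> c" for b c
  proof (cases "b = c")
    case True
    then show ?thesis using q_D that by (simp add: R_self)
  next
    case False
    then have "red b c" using that lt_total by (auto simp: red_def)
    with red [OF this that(3)] False show ?thesis by (simp add: rel_def)
  qed
  have Ker_basis: "R b c \<in> T" if "b \<in> B" "c \<in> B" "D b = 0" "D c = 0" for b c
  proof (cases "b \<prec> c")
    case True
    then have "\<not> c \<prec> b" using lt_trans lt_irrefl by blast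
    with that show ?thesis using sorted [of c b] swap [of b c] by (simp add: R_linear ht_def)
  next
    case False
    with that show ?thesis using sorted [of b c] by (simp add: ht_def)
  qed
  have basis: "R b c \<in> T" if "b \<in> B" "c \<in> B" "ht b + ht c \<le> h" for b c
  proof (cases "b \<prec> c")
    case True
    then have "\<not> c \<prec> b" using lt_trans lt_irrefl by blast
    then have "R c b \<in> T" using that sorted [of c b] by (simp add: add.commute)
    moreover have "R (D c) (D b) \<in> T"
      using D_B [OF that(1)] D_B [OF that(2)] Ker_basis [of "D c" "D b"] zero
      by (auto simp: R_linear D_D)
    ultimately show ?thesis using add swap [of b c] by simp
  qed (use that sorted in blast)
  have span: "R x y \<in> T" if "x \<in> span X" "y \<in> span Y" "\<And>b c. b \<in> X \<Longrightarrow> c \<in> Y \<Longrightarrow> R b c \<in> T" for x y X Y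
    using that(1)
  proof (induction x rule: span_induct_alt)
    case base
    show ?case by (simp add: R_linear zero)
  next
    case (step c b x)
    have "R b y \<in> T" using that(2)
    proof (induction y rule: span_induct_alt)
      case base
      show ?case by (simp add: R_linear zero)
    next
      case (step d e y)
      then show ?case using that(3) [OF \<open>b \<in> X\<close>] by (simp add: R_linear add scale)
    qed
    with step show ?case by (simp add: R_linear add scale)
  qed
  have mem_span: "x \<in> span {b \<in> B. ht b \<le> ht x}" for x
  proof (cases "D x = 0")
    case True
    then have "{b \<in> B. ht b \<le> ht x} = {b \<in> B. D b = 0}" by (auto simp: ht_def)
    then show ?thesis using Ker_D_span True by (auto simp: Ker_D_def)
  next
    case False
    then have "{b \<in> B. ht b \<le> ht x} = B" by (auto simp: ht_def)
    then show ?thesis by (simp add: span_B)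
  qed
  show "R x y \<in> T" if "ht x + ht y \<le> h" for x y
  proof (rule span [OF mem_span mem_span])
    fix b c assume "b \<in> {b \<in> B. ht b \<le> ht x}" "c \<in> {b \<in> B. ht b \<le> ht y}"
    then show "R b c \<in> T" using that by (intro basis) auto
  qed
  show "q x \<in> T" if "D x = 0" for x
  proof -
    have "x \<in> span {b \<in> B. D b = 0}" using that Ker_D_span by (auto simp: Ker_D_def)
    then have "D x = 0 \<and> q x \<in> T"
    proof (induction x rule: span_induct_alt)
      case base
      show ?case by (simp add: q_zero zero D_linear)
    next
      case (step c b x)
      have "R b x \<in> T"
      proof (rule span [of b "{b \<in> B. D b = 0}" x "{b \<in> B. D b = 0}"])
        show "x \<in> span {b \<in> B. D b = 0}" using step(2) Ker_D_span by (auto simp: Ker_D_def)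
        show "b \<in> span {b \<in> B. D b = 0}" using step(1) by (rule span_base)
      qed (auto intro: Ker_basis)
      then show ?case
        using step q_basis [of b] by (simp add: D_linear q_add q_scale R_linear add scale)
    qed
    then show ?thesis by blast
  qed
qed


subsection \<open>Confluence\<close>

text \<open>The two reductions of \<open>xyz\<close> are compared in the subspace \<open>T\<close> of those \<open>f\<close> for which \<open>u f v\<close> is a combination of
relations with smaller leading word.  \<open>T\<close> contains all \<open>R a b\<close> without a further letter (\<open>short\<close>), all
relations times a letter in which fewer letters lie outside \<open>Ker D\<close> (\<open>light\<close>), and the relations times a letter
whose leading word is a rearrangement of \<open>xyz\<close> with fewer inversions (\<open>perm\<close>).  These account for all
terms of \<open>R_overlap\<close> and \<open>q_overlap\<close> other than the two to be compared.\<close>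

lemma overlap_confluent:
  assumes u: "set u \<subseteq> B" and v: "set v \<subseteq> B" and xy: "red x y" and yz: "red y z"
  shows "word u * (rel x y * word [z] + word [x] * rel y z) * word v
    \<in> rel_span (\<lambda>w. (w, u @ [x, y, z] @ v) \<in> word_order)"
proof -
  define P where "P w \<longleftrightarrow> (w, u @ [x, y, z] @ v) \<in> word_order" for w
  define T where "T = {f. word u * f * word v \<in> rel_span P}"
  have B: "x \<in> B" "y \<in> B" "z \<in> B" using xy yz by (auto simp: red_def)
  have zero: "0 \<in> T" by (simp add: T_def rel_span_zero)
  have add: "f + g \<in> T" if "f \<in> T" "g \<in> T" for f g
    using that by (simp add: T_def distrib_left distrib_right rel_span_add)
  have scale: "const c * f \<in> T" if "f \<in> T" for c f
  proof -
    have "word u * (const c * f) * word v = const c * (word u * f * word v)"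
      by (simp only: const_left_commute [of "word u"] mult.assoc)
    then show ?thesis using that rel_span_const_mult by (simp add: T_def)
  qed
  have rel_left: "word [s] * rel a b \<in> T" if "red a b" "s \<in> B" "P (u @ [s, a, b] @ v)" for a b s
    using rel_span_base [of a b "u @ [s]" v P 1] u v that
    by (simp add: T_def mult.assoc [symmetric] single_mult_single)
  have rel_right: "rel a b * word [s] \<in> T" if "red a b" "s \<in> B" "P (u @ [a, b, s] @ v)" for a b s
    using rel_span_base [of a b u "s # v" P 1] u v that
    by (simp add: T_def mult.assoc single_mult_single)
  have short: "R a b \<in> T" for a b
  proof (rule R_q_mem [where h = "ht a + ht b", OF zero add scale])
    fix b c assume "red b c"
    then show "rel b c \<in> T"
      using u v rel_span_base [of b c u v P 1] by (simp add: T_def P_def word_order_iff)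
  qed simp_all
  have light: "word [s] * R a b \<in> T" "R a b * word [s] \<in> T"
    if s: "s \<in> B" and less: "ht s + ht a + ht b < ht x + ht y + ht z" for s a b
  proof -
    have "R a b \<in> {f. word [s] * f \<in> T}"
    proof (rule R_q_mem [where h = "ht a + ht b"])
      fix c d assume "red c d" "ht c + ht d \<le> ht a + ht b"
      then show "rel c d \<in> {f. word [s] * f \<in> T}"
        using less rel_left [of c d s] s by (simp add: P_def word_order_iff)
    qed (use zero add scale in \<open>simp_all add: distrib_left const_left_commute [of "word [s]"]\<close>)
    moreover have "R a b \<in> {f. f * word [s] \<in> T}"
    proof (rule R_q_mem [where h = "ht a + ht b"])
      fix c d assume "red c d" "ht c + ht d \<le> ht a + ht b"
      then show "rel c d \<in> {f. f * word [s] \<in> T}"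
        using less rel_right [of c d s] s by (simp add: P_def word_order_iff)
    qed (use zero add scale in \<open>simp_all add: distrib_right mult.assoc\<close>)
    ultimately show "word [s] * R a b \<in> T" "R a b * word [s] \<in> T" by simp_all
  qed
  \<comment> \<open>If \<open>a\<close> or \<open>b\<close> lies in \<open>Ker D\<close> the term vanishes; otherwise two letters move into \<open>Ker D\<close>.\<close>
  have D_terms: "emb (D b) * R (D a) c \<in> T" "R (D a) c * emb (D b) \<in> T"
    if "a \<in> B" "b \<in> B" "ht a + ht b + ht c = ht x + ht y + ht z" for a b c
  proof -
    consider "D a = 0" | "D b = 0" | "D a \<noteq> 0" "D b \<noteq> 0" "D b \<in> B"
      using D_B [OF \<open>b \<in> B\<close>] by blast
    then have "emb (D b) * R (D a) c \<in> T \<and> R (D a) c * emb (D b) \<in> T"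
    proof cases
      case 3
      then have "ht (D b) + ht (D a) + ht c < ht x + ht y + ht z"
        using that(3) by (simp add: ht_def D_D)
      from light [OF 3(3) this] show ?thesis using 3 by (simp add: emb_basis)
    qed (simp_all add: R_linear zero)
    then show "emb (D b) * R (D a) c \<in> T" "R (D a) c * emb (D b) \<in> T" by blast+
  qed
  have perm: "P (u @ t @ v)" if "mset t = mset [x, y, z]" "inversions t < inversions [x, y, z]" for t
    using word_order_perm [OF that] by (simp add: P_def)
  have asym: "\<not> b \<prec> c" if "c \<prec> b" for b c using that lt_trans lt_irrefl by blast
  have order: "y \<prec> x \<or> x = y \<and> D x = 0" "z \<prec> y \<or> y = z \<and> D y = 0"
    using xy yz by (auto simp: red_def)
  consider (xxx) "x = y" "y = z" "D x = 0" | (xxz) "x = y" "z \<prec> x" "D x = 0"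
    | (xyy) "y = z" "y \<prec> x" "D y = 0" | (xyz) "z \<prec> y" "y \<prec> x"
    using order by blast
  then have "rel x y * word [z] + word [x] * rel y z \<in> T"
  proof cases
    case xxx
    have "q x * word [x] + word [x] * q x = R (Q x) x + R x (br x x)"
      using q_overlap [OF \<open>D x = 0\<close>, of x] R_self [of x] xxx(3) B
      by (simp add: emb_basis q_zero add_ac)
    then show ?thesis using xxx by (simp add: rel_def add short)
  next
    case xxz
    then have "x \<noteq> z" using lt_irrefl by blast
    have "word [z] * rel x x \<in> T" "rel x z * word [x] \<in> T"
      using xxz asym [of z x] B lt_irrefl
      by (auto intro!: rel_left rel_right perm simp: below_count_def red_def)
    then have "rel x z * word [x] + word [z] * rel x x + R (Q x) z + R x (br x z) \<in> T"
      by (intro add short)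
    then show ?thesis using q_overlap [OF \<open>D x = 0\<close>, of z] xxz \<open>x \<noteq> z\<close> B
      by (simp add: rel_def emb_basis)
  next
    case xyy
    then have "x \<noteq> y" using lt_irrefl by blast
    have R: "R y x = R x y" using R_swap [of x y] xyy by (simp add: R_linear word_add_eq_iff)
    have "rel y y * word [x] \<in> T" "word [y] * rel x y \<in> T"
      using xyy asym [of y x] B lt_irrefl
      by (auto intro!: rel_left rel_right perm simp: below_count_def red_def)
    then have "rel y y * word [x] + word [y] * rel x y + R (Q y) x + R y (br y x) \<in> T"
      by (intro add short)
    moreover have "R x y * word [y] + word [x] * q y = q y * word [x] + word [y] * R x y + R (Q y) x + R y (br y x)"
      using q_overlap [OF \<open>D y = 0\<close>, of x] B
      by (simp add: R emb_basis add_ac word_add_eq_iff [of "q y * word [x]"])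
    ultimately show ?thesis using xyy \<open>x \<noteq> y\<close> by (simp add: rel_def)
  next
    case xyz
    then have zx: "z \<prec> x" using lt_trans by blast
    have ne: "x \<noteq> y" "y \<noteq> z" "x \<noteq> z" using xyz zx lt_irrefl by blast+
    have "word [y] * rel x z \<in> T" "rel y z * word [x] \<in> T" "rel x z * word [y] \<in> T" "word [z] * rel x y \<in> T"
      using xyz zx asym [of z x] asym [of z y] asym [of y x] B lt_irrefl
      by (auto intro!: rel_left rel_right perm simp: below_count_def red_def)
    then have "emb y * R x z \<in> T" "R y z * emb x \<in> T" "R x z * emb y \<in> T" "emb z * R x y \<in> T"
      using ne B by (simp_all add: rel_def emb_basis)
    then have "R x y * emb z + emb x * R y z \<in> T"
      unfolding R_overlap [of x y z] using B by (intro add D_terms short) simp_all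
    then show ?thesis using ne B by (simp add: rel_def emb_basis)
  qed
  then show ?thesis unfolding T_def P_def by simp
qed

text \<open>With both leading words written as relation plus tail, the products of the two relations cancel, and what
remains is a relation times a tail on either side.\<close>

lemma disjoint_confluent:
  assumes u: "set u \<subseteq> B" and m: "set m \<subseteq> B" and v: "set v \<subseteq> B"
    and xy: "red x y" and zt: "red z t"
  shows "word u * (rel x y * word (m @ [z, t]) + word ([x, y] @ m) * rel z t) * word v
    \<in> rel_span (\<lambda>w. (w, u @ [x, y] @ m @ [z, t] @ v) \<in> word_order)" (is "_ \<in> rel_span ?P")
proof -
  have B: "{x, y, z, t} \<subseteq> B" using xy zt by (auto simp: red_def)
  have left: "word u * f * (word m * rel z t * word v) \<in> rel_span ?P"
    if "Poly_Mapping.keys f \<subseteq> Poly_Mapping.keys (tail x y)" for f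
    using that
  proof (induction f rule: free_induct_keys)
    case zero
    then show ?case by (simp add: rel_span_zero)
  next
    case (add s c f)
    have "word u * Poly_Mapping.single s c * (word m * rel z t * word v)
        = Poly_Mapping.single (u @ s @ m) c * rel z t * word v"
      by (simp add: mult.assoc [symmetric] single_mult_single)
    moreover have "\<dots> \<in> rel_span ?P"
      using tail_keys(1) [OF xy add(1)] tail_keys(2) [OF xy add(1), of u "m @ [z, t] @ v"] u m v zt by (intro rel_span_base) auto
    ultimately show ?case using add(2) by (simp add: distrib_left distrib_right rel_span_add)
  qed
  have right: "(word u * rel x y * word m) * f * word v \<in> rel_span ?P"
    if "Poly_Mapping.keys f \<subseteq> Poly_Mapping.keys (tail z t)" for f
    using that
  proof (induction f rule: free_induct_keys)
    case zero
    then show ?case by (simp add: rel_span_zero)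
  next
    case (add s c f)
    have "(word u * rel x y * word m) * Poly_Mapping.single s c * word v
        = word u * rel x y * Poly_Mapping.single (m @ s @ v) c"
      by (simp add: mult.assoc single_mult_single)
    also have "\<dots> = const c * (word u * rel x y * word (m @ s @ v))"
      by (subst single_eq_const_word) (rule const_left_commute)
    finally have eq: "(word u * rel x y * word m) * Poly_Mapping.single s c * word v
      = const c * (word u * rel x y * word (m @ s @ v))" .
    have "word u * rel x y * word (m @ s @ v) \<in> rel_span ?P"
      using tail_keys(1) [OF zt add(1)] tail_keys(2) [OF zt add(1), of "u @ [x, y] @ m" v] u m v xy by (intro rel_span_base) auto
    then show ?case using add(2) rel_span_const_mult eq by (simp add: distrib_left distrib_right rel_span_add)
  qed
  have "word u * (rel x y * word (m @ [z, t]) + word ([x, y] @ m) * rel z t) * word v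
      = word u * tail x y * (word m * rel z t * word v) + (word u * rel x y * word m) * tail z t * word v"
  proof -
    have w: "word [x, y] = rel x y + tail x y" "word [z, t] = rel z t + tail z t"
      by (simp_all add: tail_def)
    have split: "word (m @ [z, t]) = word m * (word [z, t] :: _ \<Rightarrow>\<^sub>0 'k)"
      "word ([x, y] @ m) = word [x, y] * (word m :: _ \<Rightarrow>\<^sub>0 'k)"
      by (simp_all add: single_mult_single)
    show ?thesis unfolding split w by (simp add: distrib_left distrib_right mult.assoc add_ac)
  qed
  also have "\<dots> \<in> rel_span ?P" by (intro rel_span_add left right order_refl)
  finally show ?thesis .
qed

text \<open>The rules of the rewriting system: a word with a reducible pair at a chosen position, and the result of
reducing there.\<close>

definition reductions :: "('l list \<times> ('l list \<Rightarrow>\<^sub>0 'k)) set" where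
  "reductions = {(u @ [x, y] @ v, word u * tail x y * word v) | u x y v.
     red x y \<and> set u \<subseteq> B \<and> set v \<subseteq> B}"

lemma word_add_reduct:
  "word (u @ [x, y] @ v) + word u * tail x y * word v = word u * rel x y * word v"
proof -
  have eq: "word (u @ [x, y] @ v) = word u * word [x, y] * (word v :: _ \<Rightarrow>\<^sub>0 'k)"
    by (simp add: single_mult_single)
  show ?thesis unfolding eq by (simp only: tail_def distrib_left distrib_right) (simp add: add_ac)
qed

lemma reductions_confluent:
  assumes "(w, g) \<in> reductions" "(w, g') \<in> reductions"
  shows "g + g' \<in> rel_span (\<lambda>w'. (w', w) \<in> word_order)"
proof -
  have wlog: "word u * rel x y * word v + word u' * rel x' y' * word v' \<in> rel_span (\<lambda>w'. (w', w) \<in> word_order)"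
    if w: "w = u @ [x, y] @ v" "w = u' @ [x', y'] @ v'" and red: "red x y" "red x' y'"
      and B: "set u \<subseteq> B" "set v \<subseteq> B" "set u' \<subseteq> B" "set v' \<subseteq> B" and "length u \<le> length u'"
    for u x y v u' x' y' v'
  proof -
    obtain m where u': "u' = u @ m" and m: "[x, y] @ v = m @ [x', y'] @ v'"
      using w \<open>length u \<le> length u'\<close> by (auto simp: append_eq_append_conv2)
    consider "m = []" | "m = [x]" | m' where "m = x # y # m'"
      using m by (cases m; cases "tl m") auto
    then show ?thesis
    proof cases
      case 1
      then show ?thesis using m u' by (simp add: rel_span_zero)
    next
      case 2
      then have "word u * rel x y * word v + word u' * rel x' y' * word v'
          = word u * (rel x y * word [y'] + word [x] * rel y y') * word v'"
        and "y = x'" "w = u @ [x, y, y'] @ v'"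
        using m u' w single_mult_single [of "[y']" 1 v' "1::'k"] single_mult_single [of u 1 "[x]" "1::'k"]
        by (simp_all add: distrib_left distrib_right mult.assoc [symmetric]) (simp_all add: mult.assoc)
      then show ?thesis using overlap_confluent [of u v' x y y'] red B by simp
    next
      case 3
      then have v: "v = m' @ [x', y'] @ v'" using m by simp
      have "word v = word (m' @ [x', y']) * (word v' :: _ \<Rightarrow>\<^sub>0 'k)"
        "word u' = word u * (word ([x, y] @ m') :: _ \<Rightarrow>\<^sub>0 'k)"
        using v u' 3 by (simp_all add: single_mult_single)
      then have "word u * rel x y * word v + word u' * rel x' y' * word v'
          = word u * (rel x y * word (m' @ [x', y']) + word ([x, y] @ m') * rel x' y') * word v'"
        by (simp only: distrib_left distrib_right mult.assoc)
      moreover have "set m' \<subseteq> B" using B(2) v by simp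
      ultimately show ?thesis
        using disjoint_confluent [of u m' v' x y x' y'] red B w(1) v by simp
    qed
  qed
  obtain u x y v where 1: "w = u @ [x, y] @ v" "g = word u * tail x y * word v" "red x y" "set u \<subseteq> B" "set v \<subseteq> B"
    using assms(1) by (auto simp: reductions_def)
  obtain u' x' y' v' where 2: "w = u' @ [x', y'] @ v'" "g' = word u' * tail x' y' * word v'" "red x' y'"
      "set u' \<subseteq> B" "set v' \<subseteq> B"
    using assms(2) by (auto simp: reductions_def)
  have "g + g' = word u * rel x y * word v + word u' * rel x' y' * word v'"
    unfolding word_add_reduct [symmetric] 1(2) [symmetric] 2(2) [symmetric]
      1(1) [symmetric] 2(1) [symmetric] by (simp add: add_ac)
  moreover have "word u * rel x y * word v + word u' * rel x' y' * word v'
      = word u' * rel x' y' * word v' + word u * rel x y * word v" by (rule add.commute)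
  ultimately show ?thesis
    using wlog [of u x y v u' x' y' v'] wlog [of u' x' y' v' u x y v] 1 2 by (metis nat_le_linear)
qed

lemma reductions_decreasing:
  assumes "(w, g) \<in> reductions" "t \<in> Poly_Mapping.keys g"
  shows "(t, w) \<in> word_order" and "set t \<subseteq> B"
proof -
  obtain u x y v where w: "w = u @ [x, y] @ v" "g = word u * tail x y * word v" "red x y" "set u \<subseteq> B" "set v \<subseteq> B"
    using assms(1) by (auto simp: reductions_def)
  have "Poly_Mapping.keys g \<subseteq> {u @ s @ v | s. s \<in> Poly_Mapping.keys (tail x y)}"
    using Poly_Mapping.keys_mult [of "word u * tail x y" "word v"] Poly_Mapping.keys_mult [of "word u" "tail x y"]
    by (fastforce simp: w(2) plus_list_def)
  then obtain s where "t = u @ s @ v" "s \<in> Poly_Mapping.keys (tail x y)" using assms(2) by blast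
  with tail_keys(1) [OF w(3), of s] tail_keys(2) [OF w(3), of s u v] w show "(t, w) \<in> word_order" "set t \<subseteq> B" by auto
qed


subsection \<open>Normal forms\<close>

lemma normal_form_exists:
  "\<exists>\<sigma>. (\<forall>(w, g) \<in> reductions. linext \<sigma> g = \<sigma> w) \<and> (\<forall>w. (\<nexists>g. (w, g) \<in> reductions) \<longrightarrow> \<sigma> w = word w)"
proof (rule linear_confluence [OF wf_word_order])
  fix w g g' assume G: "(w, g) \<in> reductions" "(w, g') \<in> reductions"
  let ?S = "{const c * (word w1 - g1) | c w1 g1. (w1, g1) \<in> reductions \<and> (w1, w) \<in> word_order}"
  have "g + g' \<in> additive_span ?S"
    using reductions_confluent [OF G] unfolding rel_span_def
  proof (rule additive_span_image [where h = "\<lambda>f. f"])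
    fix s assume "s \<in> {Poly_Mapping.single u c * rel x y * word v | u c x y v.
      red x y \<and> set u \<subseteq> B \<and> set v \<subseteq> B \<and> (u @ [x, y] @ v, w) \<in> word_order}"
    then obtain u c x y v where s: "s = Poly_Mapping.single u c * rel x y * word v" and
      red: "red x y" "set u \<subseteq> B" "set v \<subseteq> B" "(u @ [x, y] @ v, w) \<in> word_order" by blast
    have "s = const c * (word u * rel x y * word v)"
      unfolding s by (subst single_eq_const_word) (simp only: mult.assoc)
    then have "s = const c * (word (u @ [x, y] @ v) - word u * tail x y * word v)"
      by (simp only: diff_word_eq_add word_add_reduct)
    moreover have "(u @ [x, y] @ v, word u * tail x y * word v) \<in> reductions"
      using red by (auto simp: reductions_def)
    ultimately show "s \<in> additive_span ?S" using red(4) by (intro additive_span_base) blast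
  qed simp_all
  then show "g - g' \<in> additive_span ?S" by (simp add: diff_word_eq_add)
qed (use reductions_decreasing in blast)

text \<open>The normal form of a word over \<open>B\<close>.\<close>

definition straighten :: "'l list \<Rightarrow> ('l list \<Rightarrow>\<^sub>0 'k)" where
  "straighten = (SOME s. (\<forall>(w, g) \<in> reductions. linext s g = s w) \<and>
    (\<forall>w. (\<nexists>g. (w, g) \<in> reductions) \<longrightarrow> s w = word w))"

lemma straighten_reduction: "(w, g) \<in> reductions \<Longrightarrow> straighten w = linext straighten g"
  and straighten_irreducible: "(\<nexists>g. (w, g) \<in> reductions) \<Longrightarrow> straighten w = word w"
  using someI_ex [OF normal_form_exists] unfolding straighten_def by fastforce+

lemma straighten_rel_span: "f \<in> rel_span P \<Longrightarrow> linext straighten f = 0"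
  unfolding rel_span_def
proof (induction f rule: additive_span.induct)
  case (add s f)
  then obtain u c x y v where s: "s = Poly_Mapping.single u c * rel x y * word v" and
    red: "red x y" "set u \<subseteq> B" "set v \<subseteq> B" by blast
  have "s = const c * (word u * rel x y * word v)"
    unfolding s by (subst single_eq_const_word) (simp only: mult.assoc)
  moreover have "straighten (u @ [x, y] @ v) = linext straighten (word u * tail x y * word v)"
    by (rule straighten_reduction) (use red in \<open>auto simp: reductions_def\<close>)
  ultimately have "linext straighten s = 0"
    by (simp only: word_add_reduct [symmetric] linext_const_mult linext_add linext_word) simp
  then show ?case using add by (simp add: linext_add)
qed simp

lemma reductions_induct [case_names word]:
  assumes "\<And>w. (\<And>g t. (w, g) \<in> reductions \<Longrightarrow> t \<in> Poly_Mapping.keys g \<Longrightarrow> P t) \<Longrightarrow> P w"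
  shows "P w"
  using wf_word_order
proof (induction w rule: wf_induct_rule)
  case (less w)
  then show ?case using assms reductions_decreasing by blast
qed

lemma straighten_words_below: "straighten w \<in> words_below (Suc (length w))"
proof (induction w rule: reductions_induct)
  case (word w)
  show ?case
  proof (cases "\<exists>g. (w, g) \<in> reductions")
    case True
    then obtain g where g: "(w, g) \<in> reductions" by blast
    have "straighten t \<in> words_below (Suc (length w))" if "t \<in> Poly_Mapping.keys g" for t
      using word [OF g that]
      by (rule words_below_mono) (use reductions_decreasing(1) [OF g that] in \<open>auto simp: word_order_iff\<close>)
    then show ?thesis unfolding straighten_reduction [OF g] by (rule words_below_linext)
  qed (simp add: straighten_irreducible)
qed


section \<open>Leading terms of the relations of the enveloping algebra\<close>

definition lin_rels :: "('l list \<Rightarrow>\<^sub>0 'k) set" where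
  "lin_rels = linearity_relations scale"

definition sym_rels :: "('l list \<Rightarrow>\<^sub>0 'k) set" where
  "sym_rels = {word [x] * word [y] - word [y] * word [x] - word [D y] * word [D x] | x y. True}"

definition square_rels :: "('l list \<Rightarrow>\<^sub>0 'k) set" where
  "square_rels = {word [x] * word [x] | x. D x = 0}"

definition env_rels :: "('l list \<Rightarrow>\<^sub>0 'k) set" where
  "env_rels = {word [x] * word [y] - word [y] * word [x] - word [D y] * word [D x] - word [br x y] | x y. True}"

definition restriction_rels :: "('l list \<Rightarrow>\<^sub>0 'k) set" where
  "restriction_rels = {word [x] * word [x] - word [Q x] | x. D x = 0}"

abbreviation "J_sym \<equiv> two_sided (lin_rels \<union> sym_rels \<union> square_rels)"

abbreviation "J_env \<equiv> two_sided (lin_rels \<union> env_rels \<union> restriction_rels)"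

text \<open>The algebra endomorphism of the free algebra that expands every letter in the basis \<open>B\<close>.\<close>

definition expand :: "('l list \<Rightarrow>\<^sub>0 'k) \<Rightarrow> ('l list \<Rightarrow>\<^sub>0 'k)" where
  "expand = linext (\<lambda>w. prod_list (map emb w))"

lemma expand_mult: "expand (f * g) = expand f * expand g"
  unfolding expand_def by (rule linext_mult) simp

lemma expand_letter [simp]: "expand (word [x]) = emb x"
  by (simp add: expand_def)

lemma expand_add: "expand (f + g) = expand f + expand g"
  and expand_zero [simp]: "expand 0 = 0"
  by (simp_all add: expand_def linext_add)

lemma prod_emb_keys: "t \<in> Poly_Mapping.keys (prod_list (map emb w)) \<Longrightarrow> set t \<subseteq> B \<and> length t = length w"
proof (induction w arbitrary: t)
  case Nil
  then show ?case by (simp add: word_Nil [symmetric])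
next
  case (Cons x w)
  then have "t \<in> Poly_Mapping.keys (emb x * prod_list (map emb w))" by simp
  then obtain a b where "t = a @ b" "a \<in> Poly_Mapping.keys (emb x)" "b \<in> Poly_Mapping.keys (prod_list (map emb w))"
    using Poly_Mapping.keys_mult [of "emb x" "prod_list (map emb w)"] by (auto simp: plus_list_def)
  with Cons.IH keys_emb show ?case by fastforce
qed

lemma keys_expand: "t \<in> Poly_Mapping.keys (expand f) \<Longrightarrow> set t \<subseteq> B \<and> (\<exists>w\<in>Poly_Mapping.keys f. length t = length w)"
proof -
  assume "t \<in> Poly_Mapping.keys (expand f)"
  then have "t \<in> (\<Union>w\<in>Poly_Mapping.keys f. Poly_Mapping.keys (const (Poly_Mapping.lookup f w) * prod_list (map emb w)))"
    unfolding expand_def linext_def by (rule subsetD [OF Poly_Mapping.keys_sum])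
  then obtain w where w: "w \<in> Poly_Mapping.keys f"
    "t \<in> Poly_Mapping.keys (const (Poly_Mapping.lookup f w) * prod_list (map emb w))" by blast
  then have "t \<in> Poly_Mapping.keys (prod_list (map emb w))"
    using subsetD [OF keys_const_mult] by blast
  with w(1) prod_emb_keys show ?thesis by blast
qed

lemma expand_words_below: "f \<in> words_below n \<Longrightarrow> expand f \<in> words_below n"
  unfolding words_below_def using keys_expand [of _ f] by fastforce

lemma rel_span_ideal:
  assumes f: "f \<in> rel_span (\<lambda>_. True)" and g: "\<And>t. t \<in> Poly_Mapping.keys g \<Longrightarrow> set t \<subseteq> B"
    and h: "\<And>t. t \<in> Poly_Mapping.keys h \<Longrightarrow> set t \<subseteq> B"
  shows "g * f * h \<in> rel_span (\<lambda>_. True)"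
proof -
  have left: "g' * f \<in> rel_span (\<lambda>_. True)" if "Poly_Mapping.keys g' \<subseteq> Poly_Mapping.keys g" for g'
    using that
  proof (induction g' rule: free_induct_keys)
    case (add w c g')
    then show ?case using rel_span_sandwich [OF f, of w "[]" "\<lambda>_. True" c] g
      by (simp add: distrib_right rel_span_add word_Nil)
  qed (simp add: rel_span_zero)
  have "g * f * h' \<in> rel_span (\<lambda>_. True)" if "Poly_Mapping.keys h' \<subseteq> Poly_Mapping.keys h" for h'
    using that
  proof (induction h' rule: free_induct_keys)
    case (add w c h')
    have "g * f * Poly_Mapping.single w c = const c * (g * f * word w)"
      by (subst single_eq_const_word) (rule const_left_commute)
    moreover have "g * f * word w \<in> rel_span (\<lambda>_. True)"
      using rel_span_sandwich [OF left [OF order_refl], of "[]" w "\<lambda>_. True" 1] h add(1) by (simp add: word_Nil)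
    ultimately show ?case using add(2) by (simp add: distrib_left rel_span_add rel_span_const_mult)
  qed (simp add: rel_span_zero)
  then show ?thesis by blast
qed

lemma R_q_rel_span: "R x y \<in> rel_span (\<lambda>_. True)" "D x = 0 \<Longrightarrow> q x \<in> rel_span (\<lambda>_. True)"
proof -
  have "rel b c \<in> rel_span (\<lambda>_. True)" if "red b c" for b c
    using rel_span_base [OF that, of "[]" "[]" _ 1] by (simp add: word_Nil)
  then show "R x y \<in> rel_span (\<lambda>_. True)" "D x = 0 \<Longrightarrow> q x \<in> rel_span (\<lambda>_. True)"
    by (simp_all add: R_q_mem [OF rel_span_zero rel_span_add rel_span_const_mult, where h = "ht x + ht y"])
qed

text \<open>The normal form of an arbitrary element: expand in the basis, then straighten.\<close>

definition nf :: "('l list \<Rightarrow>\<^sub>0 'k) \<Rightarrow> ('l list \<Rightarrow>\<^sub>0 'k)" where "nf f = linext straighten (expand f)"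

lemma nf_add: "nf (f + g) = nf f + nf g"
  and nf_zero: "nf 0 = 0"
  by (simp_all add: nf_def expand_add linext_add)

lemma nf_words_below: "f \<in> words_below n \<Longrightarrow> nf f \<in> words_below n"
  unfolding nf_def
proof (rule words_below_linext)
  fix w assume f: "f \<in> words_below n" and "w \<in> Poly_Mapping.keys (expand f)"
  then have "length w < n" using expand_words_below [OF f] by (auto simp: words_below_def)
  then show "straighten w \<in> words_below n" using straighten_words_below [of w] words_below_mono by (metis Suc_leI)
qed

text \<open>Expansion turns the defining relations of \<open>U\<^sub>r\<^sub>e\<^sub>s(L)\<close> into \<open>0\<close>, \<open>R x y\<close> and \<open>q x\<close>, and straightening kills the
ideal they generate in the free algebra on \<open>B\<close>.\<close>

lemma nf_J_env:
  assumes "f \<in> J_env"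
  shows "nf f = 0"
proof -
  have "f \<in> {f. nf f = 0}"
    using assms
  proof (rule two_sided_least)
    fix u c s v assume "s \<in> lin_rels \<union> env_rels \<union> restriction_rels"
    then have "expand s \<in> rel_span (\<lambda>_. True)"
    proof (elim UnE)
      assume "s \<in> lin_rels"
      then have "expand s = 0"
        by (auto simp: lin_rels_def linearity_relations_def diff_word_eq_add expand_add emb_add emb_scale
            expand_def linext_single linext_add add_ac word_Nil)
      then show ?thesis by (simp add: rel_span_zero)
    next
      assume "s \<in> env_rels"
      then obtain x y where "s = word [x] * word [y] - word [y] * word [x] - word [D y] * word [D x] - word [br x y]"
        by (auto simp: env_rels_def)
      then have "expand s = R x y"
        by (simp only: diff_word_eq_add expand_add expand_mult expand_letter R_def)
      then show ?thesis by (simp add: R_q_rel_span)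
    next
      assume "s \<in> restriction_rels"
      then obtain x where "s = word [x] * word [x] - word [Q x]" "D x = 0"
        by (auto simp: restriction_rels_def)
      then have "expand s = q x"
        by (simp only: diff_word_eq_add expand_add expand_mult expand_letter q_def)
      then show ?thesis by (simp add: R_q_rel_span \<open>D x = 0\<close>)
    qed
    then have "expand (Poly_Mapping.single u c * s * word v) \<in> rel_span (\<lambda>_. True)"
      unfolding expand_mult by (rule rel_span_ideal) (use keys_expand in blast)+
    then show "Poly_Mapping.single u c * s * word v \<in> {f. nf f = 0}"
      by (simp add: nf_def straighten_rel_span)
  qed (simp_all add: nf_add nf_zero)
  then show ?thesis by simp
qed

lemma letter_add_emb: "word [x] + emb x \<in> two_sided lin_rels"
proof -
  have add: "word [x + y] + word [x] + word [y] \<in> two_sided lin_rels" for x y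
    by (rule two_sided_base) (auto simp: lin_rels_def linearity_relations_def diff_word_eq_add)
  have scale: "word [scale c x] + Poly_Mapping.single [x] c \<in> two_sided lin_rels" for c x
    by (rule two_sided_base) (auto simp: lin_rels_def linearity_relations_def diff_word_eq_add)
  have "x \<in> span B" by (simp add: span_B)
  then show ?thesis
  proof (induction x rule: span_induct_alt)
    case base
    show ?case using add [of 0 0] by simp
  next
    case (step c b y)
    have "word [scale c b + y] + emb (scale c b + y)
        = (word [scale c b + y] + word [scale c b] + word [y])
          + (word [scale c b] + Poly_Mapping.single [b] c) + (word [y] + emb y)"
      by (simp add: emb_add emb_scale emb_basis step single_mult_single add_ac)
    then show ?case using add scale step two_sided_add by metis
  qed
qed

lemma add_expand_mem: "f + expand f \<in> two_sided lin_rels"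
proof -
  have word: "word w + expand (word w) \<in> two_sided lin_rels" for w
  proof (induction w)
    case Nil
    then show ?case by (simp add: expand_def word_Nil [symmetric])
  next
    case (Cons x w)
    have "word (x # w) = word [x] * (word w :: _ \<Rightarrow>\<^sub>0 'k)" by (simp add: single_mult_single)
    then have "word (x # w) + expand (word (x # w))
        = (word [x] + emb x) * word w + emb x * (word w + expand (word w))"
      by (simp only: expand_mult expand_letter) (simp add: distrib_left distrib_right add_ac)
    then show ?case
      using letter_add_emb Cons by (simp add: two_sided_add two_sided_mult_left two_sided_mult_right)
  qed
  show ?thesis
  proof (induction f rule: free_induct)
    case (add w c f)
    have eq: "Poly_Mapping.single w c + f + expand (Poly_Mapping.single w c + f)
        = const c * (word w + expand (word w)) + (f + expand f)"
      by (simp add: expand_def linext_add linext_single distrib_left single_mult_single word_Nil add_ac)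
    show ?case unfolding eq by (intro two_sided_add two_sided_mult_left word add.IH)
  qed simp
qed

text \<open>The elements that vanish modulo \<open>J_sym\<close> and degree less than \<open>n\<close>.\<close>

definition lower :: "nat \<Rightarrow> ('l list \<Rightarrow>\<^sub>0 'k) set" where
  "lower n = {f + g | f g. f \<in> J_sym \<and> g \<in> words_below n}"

lemma lower_add: "f \<in> lower n \<Longrightarrow> g \<in> lower n \<Longrightarrow> f + g \<in> lower n"
proof -
  assume "f \<in> lower n" "g \<in> lower n"
  then obtain a b c d where "f = a + b" "a \<in> J_sym" "b \<in> words_below n"
    and "g = c + d" "c \<in> J_sym" "d \<in> words_below n" by (auto simp: lower_def)
  then have "f + g = (a + c) + (b + d)" "a + c \<in> J_sym" "b + d \<in> words_below n"
    by (simp_all add: add_ac two_sided_add words_below_add)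
  then show ?thesis unfolding lower_def by blast
qed

lemma lower_mono: "f \<in> lower m \<Longrightarrow> m \<le> n \<Longrightarrow> f \<in> lower n"
  unfolding lower_def using words_below_mono by blast

lemma J_sym_lower: "f \<in> J_sym \<Longrightarrow> f \<in> lower n"
  unfolding lower_def by (rule CollectI) (metis add_0_right zero_in_words_below)

lemma words_below_lower: "f \<in> words_below n \<Longrightarrow> f \<in> lower n"
  unfolding lower_def by (rule CollectI) (metis add_0_left two_sided_zero)

lemma lower_linext:
  assumes "\<And>w. w \<in> Poly_Mapping.keys f \<Longrightarrow> word w + \<phi> w \<in> lower n"
  shows "f + linext \<phi> f \<in> lower n"
proof -
  have "f' + linext \<phi> f' \<in> lower n" if "Poly_Mapping.keys f' \<subseteq> Poly_Mapping.keys f" for f'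
    using that
  proof (induction f' rule: free_induct_keys)
    case zero
    then show ?case using J_sym_lower [OF two_sided_zero] by simp
  next
    case (add w c f')
    obtain a b where ab: "word w + \<phi> w = a + b" "a \<in> J_sym" "b \<in> words_below n"
      using assms [OF add(1)] by (auto simp: lower_def)
    have mem: "const c * (word w + \<phi> w) \<in> lower n"
      unfolding ab(1) distrib_left
      by (intro lower_add J_sym_lower words_below_lower two_sided_mult_left words_below_const_mult ab)
    have eq: "Poly_Mapping.single w c + f' + linext \<phi> (Poly_Mapping.single w c + f')
        = const c * (word w + \<phi> w) + (f' + linext \<phi> f')"
      by (simp add: linext_add linext_single distrib_left single_mult_single add_ac)
    show ?case unfolding eq by (rule lower_add [OF mem add(2)])
  qed
  then show ?thesis by blast
qed

lemma lin_rels_J_sym: "f \<in> two_sided lin_rels \<Longrightarrow> f \<in> J_sym"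
  by (rule subsetD [OF two_sided_mono]) (auto intro: two_sided_base)

text \<open>A rule changes a word by a multiple of a defining relation of \<open>SL/((Ker D)\<^sup>2)\<close> and a term with one
letter less.\<close>

lemma rel_lower:
  assumes "red x y"
  shows "word u * rel x y * word v \<in> lower (Suc (Suc (length u + length v)))"
proof -
  have letter: "emb x + word [x] \<in> J_sym" for x
    using lin_rels_J_sym [OF letter_add_emb [of x]] by (simp only: add.commute)
  have emb: "f * emb x + f * word [x] \<in> J_sym" "emb x * f + word [x] * f \<in> J_sym" for f x
    unfolding distrib_left [symmetric] distrib_right [symmetric]
    by (intro two_sided_mult_left two_sided_mult_right letter)+
  have emb_below: "emb a \<in> words_below (Suc (Suc 0))" for a
    unfolding words_below_def using keys_emb [of _ a] by fastforce
  obtain f a where f: "f \<in> J_sym" "rel x y = f + emb a"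
  proof (cases "x = y")
    case True
    have "D x = 0" using assms True lt_irrefl by (auto simp: red_def)
    then have "word [x] * word [x] \<in> J_sym" by (intro two_sided_base) (auto simp: square_rels_def)
    from two_sided_add [OF this two_sided_add [OF emb(1) [of "emb x" x] emb(2) [of x "word [x]"]]]
    have "emb x * emb x \<in> J_sym" by (simp add: add_ac)
    then show thesis using that True by (simp add: rel_def q_def)
  next
    case False
    have two: "emb a * emb b + word [a] * word [b] \<in> J_sym" for a b
      using two_sided_add [OF emb(1) [of "emb a" b] emb(2) [of a "word [b]"]] by (simp add: add_ac)
    have "word [x] * word [y] + word [y] * word [x] + word [D y] * word [D x] \<in> J_sym"
      by (rule two_sided_base) (auto simp: sym_rels_def diff_word_eq_add)
    from two_sided_add [OF this two_sided_add [OF two_sided_add [OF two [of x y] two [of y x]] two [of "D y" "D x"]]]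
    have "emb x * emb y + emb y * emb x + emb (D y) * emb (D x) \<in> J_sym" by (simp add: add_ac)
    then show thesis using that False by (simp add: rel_def R_def)
  qed
  have "word u * emb a * word v \<in> words_below (Suc (Suc (length u + length v)))"
  proof -
    have "word u * emb a \<in> words_below (Suc (length u) + Suc (Suc 0) - 1)"
      by (rule words_below_mult) (simp_all add: emb_below)
    then have "word u * emb a * word v \<in> words_below (Suc (length u) + Suc (Suc 0) - 1 + Suc (length v) - 1)"
      by (rule words_below_mult) simp
    then show ?thesis by simp
  qed
  moreover have "word u * f * word v \<in> J_sym"
    using f(1) by (intro two_sided_mult_right two_sided_mult_left)
  ultimately show ?thesis
    unfolding f(2) distrib_left distrib_right by (intro lower_add J_sym_lower words_below_lower)
qed

lemma add_straighten_lower: "word w + straighten w \<in> lower (length w)"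
proof (induction w rule: reductions_induct)
  case (word w)
  show ?case
  proof (cases "\<exists>g. (w, g) \<in> reductions")
    case True
    then obtain u x y v where w: "w = u @ [x, y] @ v" and red: "red x y"
      and g: "(w, word u * tail x y * word v) \<in> reductions"
      unfolding reductions_def by blast
    let ?g = "word u * tail x y * word v"
    have "word w + ?g \<in> lower (length w)"
      unfolding w word_add_reduct using rel_lower [OF red, of u v] by simp
    moreover have "?g + linext straighten ?g \<in> lower (length w)"
    proof (rule lower_linext)
      fix t assume t: "t \<in> Poly_Mapping.keys ?g"
      show "word t + straighten t \<in> lower (length w)"
        using word [OF g t]
        by (rule lower_mono) (use reductions_decreasing(1) [OF g t] in \<open>auto simp: word_order_iff\<close>)
    qed
    ultimately have "(word w + ?g) + (?g + linext straighten ?g) \<in> lower (length w)" by (rule lower_add)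
    then show ?thesis by (simp add: straighten_reduction [OF g] add_ac)
  next
    case False
    then show ?thesis by (simp add: straighten_irreducible J_sym_lower)
  qed
qed

lemma add_nf_lower:
  assumes "f \<in> words_below (Suc n)"
  shows "f + nf f \<in> lower n"
proof -
  have "f + expand f \<in> lower n"
    by (intro J_sym_lower lin_rels_J_sym add_expand_mem)
  moreover have "expand f + linext straighten (expand f) \<in> lower n"
  proof (rule lower_linext)
    fix w assume "w \<in> Poly_Mapping.keys (expand f)"
    then have "length w \<le> n" using expand_words_below [OF assms] by (auto simp: words_below_def)
    then show "word w + straighten w \<in> lower n" using add_straighten_lower lower_mono by blast
  qed
  ultimately have "(f + expand f) + (expand f + linext straighten (expand f)) \<in> lower n" by (rule lower_add)
  then show ?thesis by (simp add: nf_def add_ac)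
qed

text \<open>Every defining relation of \<open>SL/((Ker D)\<^sup>2)\<close> is homogeneous, and is the leading term of the corresponding
relation of \<open>U\<^sub>r\<^sub>e\<^sub>s(L)\<close>.\<close>

lemma J_sym_generator_cases:
  assumes "s \<in> lin_rels \<union> sym_rels \<union> square_rels"
  obtains d g where "s = component d s" "s + g \<in> J_env" "g \<in> words_below d"
  using assms
proof (elim UnE)
  assume s: "s \<in> lin_rels"
  then have "component 1 s = s"
    by (auto simp: lin_rels_def linearity_relations_def component_diff component_single)
  moreover have "s + 0 \<in> J_env" using s by (simp add: two_sided_base)
  ultimately show thesis using that [of 1 0] by simp
next
  assume "s \<in> sym_rels"
  then obtain x y where s: "s = word [x] * word [y] - word [y] * word [x] - word [D y] * word [D x]"
    by (auto simp: sym_rels_def)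
  have "component 2 s = s"
    by (simp add: s component_diff component_single single_mult_single)
  moreover have "s - word [br x y] \<in> J_env"
    unfolding s by (rule two_sided_base) (auto simp: env_rels_def)
  ultimately show thesis using that [of 2 "- word [br x y]"] by (simp add: diff_word_eq_add)
next
  assume "s \<in> square_rels"
  then obtain x where s: "s = word [x] * word [x]" "D x = 0"
    by (auto simp: square_rels_def)
  have "component 2 s = s"
    by (simp add: s component_single single_mult_single)
  moreover have "s - word [Q x] \<in> J_env"
    unfolding s by (rule two_sided_base) (use s in \<open>auto simp: restriction_rels_def\<close>)
  ultimately show thesis using that [of 2 "- word [Q x]"] by (simp add: diff_word_eq_add)
qed

lemma component_homogeneous:
  assumes "s = component d s"
  shows "component n (Poly_Mapping.single u c * s * word v)
    = (if n = length u + d + length v then Poly_Mapping.single u c * s * word v else 0)"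
proof -
  have keys: "length w = d" if "w \<in> Poly_Mapping.keys s" for w
    using that lookup_component [of d s w] assms by (auto simp: in_keys_iff split: if_splits)
  have "component n (Poly_Mapping.single u c * f * word v)
    = (if n = length u + d + length v then Poly_Mapping.single u c * f * word v else 0)"
    if "Poly_Mapping.keys f \<subseteq> Poly_Mapping.keys s" for f
    using that
  proof (induction f rule: free_induct_keys)
    case (add w e f)
    then show ?case using keys [OF add(1)]
      by (auto simp: distrib_left distrib_right component_add single_mult_single component_single)
  qed simp
  then show ?thesis by blast
qed

lemma J_sym_component:
  assumes "f \<in> J_sym"
  shows "component n f \<in> J_sym" "\<exists>j\<in>J_env. component n f - j \<in> words_below n"
proof -
  let ?I = "{f. component n f \<in> J_sym \<and> (\<exists>g. component n f + g \<in> J_env \<and> g \<in> words_below n)}"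
  have "f \<in> ?I"
    using assms
  proof (rule two_sided_least)
    show "0 \<in> ?I" by (auto intro!: exI [of _ 0])
    show "x + y \<in> ?I" if "x \<in> ?I" "y \<in> ?I" for x y
    proof -
      obtain g where g: "component n x + g \<in> J_env" "g \<in> words_below n"
        using \<open>x \<in> ?I\<close> by blast
      obtain h where h: "component n y + h \<in> J_env" "h \<in> words_below n"
        using \<open>y \<in> ?I\<close> by blast
      have "component n (x + y) + (g + h) \<in> J_env"
        using two_sided_add [OF g(1) h(1)] by (simp add: component_add add_ac)
      then show ?thesis
        using that words_below_add [OF g(2) h(2)] by (auto simp: component_add two_sided_add)
    qed
    fix u c s v assume s: "s \<in> lin_rels \<union> sym_rels \<union> square_rels"
    then obtain d g where d: "s = component d s" "s + g \<in> J_env" "g \<in> words_below d"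
      by (rule J_sym_generator_cases)
    show "Poly_Mapping.single u c * s * word v \<in> ?I"
    proof (cases "n = length u + d + length v")
      case True
      have "Poly_Mapping.single u c * (s + g) * word v \<in> J_env"
        using d(2) by (intro two_sided_mult_left two_sided_mult_right)
      moreover have "Poly_Mapping.single u c * g * word v \<in> words_below n"
      proof (cases "d = 0")
        case False
        have "Poly_Mapping.single u c * g * word v \<in> words_below ((Suc (length u) + d - 1) + Suc (length v) - 1)"
          using d(3) by (intro words_below_mult) simp_all
        then show ?thesis using True False by simp
      qed (use d(3) in simp)
      ultimately show ?thesis
        using component_homogeneous [OF d(1), of n u c v] True two_sided_gen [OF s, of u c v]
        by (auto simp: distrib_left distrib_right)
    next
      case False
      then show ?thesis
        using component_homogeneous [OF d(1), of n u c v] by (auto intro!: exI [of _ 0])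
    qed
  qed
  then show "component n f \<in> J_sym" "\<exists>j\<in>J_env. component n f - j \<in> words_below n"
    by (auto intro!: bexI simp: words_below_uminus)
qed

text \<open>For \<open>f\<close> in the set on the left, the component \<open>c = component n f\<close> agrees with some \<open>j \<in> J_env\<close> up to lower
degree.  As \<open>nf\<close> kills \<open>j\<close>, \<open>nf c\<close> has lower degree, while \<open>c + nf c\<close> is in \<open>J_sym\<close> up to lower degree; since
\<open>c\<close> and \<open>J_sym\<close> are homogeneous, \<open>c \<in> J_sym\<close>.\<close>

theorem leading_terms:
  "{f. \<forall>n. \<exists>j\<in>J_env. component n f - j \<in> words_below n} = J_sym"
proof (intro equalityI subsetI)
  fix f assume f: "f \<in> {f. \<forall>n. \<exists>j\<in>J_env. component n f - j \<in> words_below n}"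
  have comp: "component n f \<in> J_sym" for n
  proof -
    obtain j where j: "j \<in> J_env" "component n f - j \<in> words_below n" using f by blast
    have "nf (component n f) = nf (component n f - j)"
      using nf_add [of "component n f - j" j] nf_J_env [OF j(1)] by simp
    then have "nf (component n f) \<in> lower n"
      using nf_words_below [OF j(2)] by (simp add: words_below_lower)
    moreover have "component n f + nf (component n f) \<in> lower n"
      by (rule add_nf_lower) simp
    ultimately have "nf (component n f) + (component n f + nf (component n f)) \<in> lower n"
      by (rule lower_add)
    then have "component n f \<in> lower n" by (simp add: add_ac)
    then obtain a b where ab: "component n f = a + b" "a \<in> J_sym" "b \<in> words_below n"
      by (auto simp: lower_def)
    have "component n f = component n (component n f)" by (simp add: component_component)
    also have "\<dots> = component n a"
      unfolding ab(1) by (simp add: component_add component_eq_0 [OF ab(3)])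
    finally show ?thesis using J_sym_component(1) [OF ab(2)] by simp
  qed
  obtain N where "f \<in> words_below N" using exists_words_below by blast
  then have "f = (\<Sum>i<N. component i f)" by (rule sum_component [symmetric])
  moreover have "(\<Sum>i<M. component i f) \<in> J_sym" for M
    by (induction M) (simp_all add: comp two_sided_add)
  ultimately show "f \<in> J_sym" by metis
next
  fix f assume "f \<in> J_sym"
  then show "f \<in> {f. \<forall>n. \<exists>j\<in>J_env. component n f - j \<in> words_below n}"
    using J_sym_component(2) by blast
qed


section \<open>The natural map\<close>

abbreviation "to_T f \<equiv> tensor_ideal scale +>\<^bsub>word_algebra\<^esub> f"
abbreviation "to_S f \<equiv> sym_ideal scale D +>\<^bsub>tensor_algebra scale\<^esub> to_T f"
abbreviation "to_S_res f \<equiv> sym_res_ideal scale D +>\<^bsub>sym_algebra scale D\<^esub> to_S f"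
abbreviation "to_U f \<equiv> env_ideal scale D br +>\<^bsub>tensor_algebra scale\<^esub> to_T f"
abbreviation "to_U_res f \<equiv> res_ideal scale D br Q +>\<^bsub>env_algebra scale D br\<^esub> to_U f"

lemma tensor_presentation: "ring_presentation (tensor_algebra scale) to_T (two_sided lin_rels)"
  using ring_presentation.quotient_presentation [OF word_algebra_presentation two_sided_empty [symmetric], of lin_rels]
  by (simp add: lin_rels_def tensor_algebra_def tensor_ideal_def)

lemma sym_presentation: "ring_presentation (sym_algebra scale D) to_S (two_sided (lin_rels \<union> sym_rels))"
proof -
  interpret T: ring_presentation "tensor_algebra scale" to_T "two_sided lin_rels"
    by (rule tensor_presentation)
  have "sym_ideal scale D = Idl\<^bsub>tensor_algebra scale\<^esub> (to_T ` sym_rels)"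
    unfolding sym_ideal_def Let_def tensor_gen_def sym_rels_def
      T.p_mult [symmetric] T.p_diff [symmetric]
    by (intro arg_cong [of _ _ "genideal _"]) blast
  then show ?thesis
    using T.quotient_presentation [OF refl, of sym_rels] by (simp add: sym_algebra_def)
qed

lemma sym_res_presentation: "ring_presentation (sym_res_algebra scale D) to_S_res J_sym"
proof -
  interpret S: ring_presentation "sym_algebra scale D" to_S "two_sided (lin_rels \<union> sym_rels)"
    by (rule sym_presentation)
  have "sym_res_ideal scale D = Idl\<^bsub>sym_algebra scale D\<^esub> (to_S ` square_rels)"
    unfolding sym_res_ideal_def sym_gen_def tensor_gen_def square_rels_def
      S.p_square [symmetric]
    by (intro arg_cong [of _ _ "genideal _"]) blast
  then show ?thesis
    using S.quotient_presentation [OF refl, of square_rels] by (simp add: sym_res_algebra_def)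
qed

lemma env_presentation: "ring_presentation (env_algebra scale D br) to_U (two_sided (lin_rels \<union> env_rels))"
proof -
  interpret T: ring_presentation "tensor_algebra scale" to_T "two_sided lin_rels"
    by (rule tensor_presentation)
  have "env_ideal scale D br = Idl\<^bsub>tensor_algebra scale\<^esub> (to_T ` env_rels)"
    unfolding env_ideal_def Let_def tensor_gen_def env_rels_def
      T.p_mult [symmetric] T.p_diff [symmetric]
    by (intro arg_cong [of _ _ "genideal _"]) blast
  then show ?thesis
    using T.quotient_presentation [OF refl, of env_rels] by (simp add: env_algebra_def)
qed

lemma res_env_presentation: "ring_presentation (res_env_algebra scale D br Q) to_U_res J_env"
proof -
  interpret U: ring_presentation "env_algebra scale D br" to_U "two_sided (lin_rels \<union> env_rels)"
    by (rule env_presentation)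
  have "res_ideal scale D br Q = Idl\<^bsub>env_algebra scale D br\<^esub> (to_U ` restriction_rels)"
    unfolding res_ideal_def env_C_def Let_def env_gen_def tensor_gen_def restriction_rels_def
      U.p_square [symmetric] U.p_diff [symmetric]
    by (intro arg_cong [of _ _ "genideal _"]) blast
  then show ?thesis
    using U.quotient_presentation [OF refl, of restriction_rels] by (simp add: res_env_algebra_def)
qed

text \<open>The source and the target of \<open>\<xi>\<close> are quotients of the free algebra by the same ideal.\<close>

lemma natural_map_iso:
  "(\<exists>!\<xi>. is_natural_map scale D br Q \<xi>) \<and>
    (\<forall>\<xi>. is_natural_map scale D br Q \<xi> \<longrightarrow>
       \<xi> \<in> algebra_iso (sym_res_algebra scale D) (gr_res_env scale D br Q))"
proof -
  interpret S: ring_presentation "sym_res_algebra scale D" to_S_res J_sym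
    by (rule sym_res_presentation)
  interpret U: ring_presentation "res_env_algebra scale D br Q" to_U_res J_env
    by (rule res_env_presentation)
  have fil: "res_env_fil scale D br Q = U.fil"
    by (rule ext) (simp add: res_env_fil_def tensor_fil_def U.fil_def words_below_def image_image less_Suc_eq_le)
  have gr: "algebra_presentation (gr_res_env scale D br Q) (\<lambda>f n. U.symbol n (component n f)) J_sym"
    using U.gr_presentation unfolding leading_terms gr_res_env_def fil .
  have natural: "is_natural_map scale D br Q \<xi> \<longleftrightarrow>
      \<xi> \<in> algebra_hom (sym_res_algebra scale D) (gr_res_env scale D br Q) \<and>
      \<xi> \<in> extensional (carrier (sym_res_algebra scale D)) \<and>
      (\<forall>x. \<xi> (to_S_res (word [x])) = (\<lambda>n. U.symbol n (component n (word [x]))))" for \<xi>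
    unfolding is_natural_map_def sym_res_gen_def sym_gen_def tensor_gen_def res_env_gen_def env_gen_def
      fil U.gr_class_generator ..
  show ?thesis
    unfolding natural by (rule presentation_iso [OF S.algebra_presentation_axioms gr])
qed

end

theorem theorem3p30:
  fixes scale :: "'k::field \<Rightarrow> 'l::ab_group_add \<Rightarrow> 'l"
    and D :: "'l \<Rightarrow> 'l" and br :: "'l \<Rightarrow> 'l \<Rightarrow> 'l" and L0 L1 :: "'l set" and Q :: "'l \<Rightarrow> 'l"
  assumes "restricted_lie_superalgebra_ver4p scale D br L0 L1 Q"
  shows "(\<exists>!\<xi>. is_natural_map scale D br Q \<xi>) \<and>
    (\<forall>\<xi>. is_natural_map scale D br Q \<xi> \<longrightarrow>
       \<xi> \<in> algebra_iso (sym_res_algebra scale D) (gr_res_env scale D br Q))"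
proof -
  interpret restricted_lie_superalgebra_ver4p scale D br L0 L1 Q by fact
  obtain B where B: "independent B" "span B = UNIV" "Ker_D \<subseteq> span {b \<in> B. D b = 0}"
    "\<forall>b\<in>B. D b = 0 \<or> D b \<in> B"
    using exists_adapted_basis by blast
  \<comment> \<open>Straightening needs a strict total order on the basis; one on all of \<open>L\<close> is provided by the
    well-ordering theorem.\<close>
  obtain r :: "('l \<times> 'l) set" where "well_order_on UNIV r"
    using well_order_on by blast
  then have r: "antisym r" "trans r" "total_on UNIV r"
    by (auto simp: well_order_on_def linear_order_on_def partial_order_on_def preorder_on_def)
  define lt where "lt b c \<longleftrightarrow> (b, c) \<in> r \<and> b \<noteq> c" for b c
  interpret adapted_basis scale D br L0 L1 Q B lt
  proof unfold_locales
    show "lt b d" if "lt b c" "lt c d" for b c d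
      using that r(1,2) by (auto simp: lt_def dest: transD antisymD)
    show "lt b c \<or> lt c b" if "b \<noteq> c" for b c
      using that r(3) by (auto simp: lt_def total_on_def)
  qed (use B in \<open>auto simp: lt_def\<close>)
  show ?thesis by (rule natural_map_iso)
qed

end
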